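(* Let $f\in Hol(D,\mathbb{B})$. The following are equivalent: (1) For every $\phi\in C^\infty(\partial D)$ the limit $$\langle f_b,\phi\rangle:=\lim_{r\nearrow 1}\int_0^{2\pi} f(re^{i\theta})\,\phi(\theta)\,d\theta$$ exists. (2) There is a ($\mathbb{B}$-valued) distribution $f_b=p^+f_b^++p^-f_b^-$ on $\partial D$, with $f_b^\pm\in\mathcal{D}'(\partial D)$, such that for all $0\le r<1$ and all $\theta$ $$f(re^{i\theta})=p^+\left(\frac{1}{2\pi}\langle (f_b^+)^*,P_r(\theta-\cdot)\rangle\right)^*+p^-\,\frac{1}{2\pi}\langle f_b^-,P_r(\theta-\cdot)\rangle,$$ where $P_r(\theta)=\dfrac{1-r^2}{1-2r\cos\theta+r^2}$ is the Poisson kernel on $D$. (3) There are constants $C>0$ and $\alpha\ge 0$ such that $$\|f(re^{i\theta})\|_{\mathbb{B}}\le \frac{C}{(1-r)^\alpha}$$ for all $0\le r<1$ and all $\theta$.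
   Context: $D$ is the open unit disk in $\mathbb{C}$ and $\partial D$ the unit circle. For $u\in\mathbb{C}$, $u^*$ denotes the complex conjugate. $\mathbb{B}$ denotes the bicomplex numbers: the commutative $\mathbb{C}$-algebra of elements $z_1+jz_2$ with $z_1,z_2\in\mathbb{C}$, $j^2=-1$, $ij=ji$. Put $p^\pm=\frac12(1\pm ij)$; these are idempotents with $p^+p^-=0$. Each $w=z_1+jz_2\in\mathbb{B}$ is uniquely $w=p^+w^++p^-w^-$ with $w^\pm\in\mathbb{C}$, namely $w^\pm=z_1\mp iz_2$. For functions, $f^\pm$ is defined pointwise. The norm is $\|w\|_{\mathbb{B}}=\sqrt{(|w^+|^2+|w^-|^2)/2}$. The operator $\bar\partial=\frac12(\partial_x+j\partial_y)=p^+\frac{\partial}{\partial z}+p^-\frac{\partial}{\partial z^*}$. $Hol(D,\mathbb{B})$ is the set of $f:D\to\mathbb{B}$ with $\bar\partial f=0$; equivalently, $(f^+)^*$ and $f^-$ are ordinary complex holomorphic functions on $D$. Elements of $C^\infty(\partial D)$ are complex-valued and regarded as smooth $2\pi$-periodic functions of $\theta$; $\mathcal{D}'(\partial D)$ is the space of (complex) distributions on $\partial D$. For $u\in\mathcal{D}'(\partial D)$, the conjugate distribution is $\langle u^*,\phi\rangle=(\langle u,\phi^*\rangle)^*$. *)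

theory Defs
  imports "HOL-Complex_Analysis.Complex_Analysis"
begin

section \<open>Bicomplex numbers\<close>

text \<open>\<open>Bicomplex z1 z2\<close> stands for \<open>z1 + j z2\<close>, where \<open>j\<^sup>2 = -1\<close> and \<open>j\<close> commutes with the
  complex unit.\<close>

datatype bicomplex = Bicomplex (bc_fst: complex) (bc_snd: complex)

lemma bicomplex_eq_iff: "w = v \<longleftrightarrow> bc_fst w = bc_fst v \<and> bc_snd w = bc_snd v"
  by (cases w; cases v) simp

instantiation bicomplex :: comm_ring_1
begin

definition zero_bicomplex :: bicomplex where "0 = Bicomplex 0 0"

definition one_bicomplex :: bicomplex where "1 = Bicomplex 1 0"

definition plus_bicomplex :: "bicomplex \<Rightarrow> bicomplex \<Rightarrow> bicomplex" where
  "w + v = Bicomplex (bc_fst w + bc_fst v) (bc_snd w + bc_snd v)"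

definition minus_bicomplex :: "bicomplex \<Rightarrow> bicomplex \<Rightarrow> bicomplex" where
  "w - v = Bicomplex (bc_fst w - bc_fst v) (bc_snd w - bc_snd v)"

definition uminus_bicomplex :: "bicomplex \<Rightarrow> bicomplex" where
  "- w = Bicomplex (- bc_fst w) (- bc_snd w)"

definition times_bicomplex :: "bicomplex \<Rightarrow> bicomplex \<Rightarrow> bicomplex" where
  "w * v = Bicomplex (bc_fst w * bc_fst v - bc_snd w * bc_snd v)
                     (bc_fst w * bc_snd v + bc_snd w * bc_fst v)"

instance
  by standard
     (simp_all add: bicomplex_eq_iff zero_bicomplex_def one_bicomplex_def plus_bicomplex_def
       minus_bicomplex_def uminus_bicomplex_def times_bicomplex_def algebra_simps)

end

definition bc_of_complex :: "complex \<Rightarrow> bicomplex" where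
  "bc_of_complex z = Bicomplex z 0"

definition bc_j :: bicomplex where
  "bc_j = Bicomplex 0 1"

definition bc_pplus :: bicomplex where
  "bc_pplus = bc_of_complex (1/2) * (1 + bc_of_complex \<i> * bc_j)"

definition bc_pminus :: bicomplex where
  "bc_pminus = bc_of_complex (1/2) * (1 - bc_of_complex \<i> * bc_j)"

definition bc_plus :: "bicomplex \<Rightarrow> complex" where
  "bc_plus w = bc_fst w - \<i> * bc_snd w"

definition bc_minus :: "bicomplex \<Rightarrow> complex" where
  "bc_minus w = bc_fst w + \<i> * bc_snd w"

lemmas bc_ops_defs = zero_bicomplex_def one_bicomplex_def plus_bicomplex_def
  minus_bicomplex_def uminus_bicomplex_def times_bicomplex_def bc_of_complex_def bc_j_def

lemma bc_decomposition:
  "w = bc_pplus * bc_of_complex (bc_plus w) + bc_pminus * bc_of_complex (bc_minus w)"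
  by (simp add: bicomplex_eq_iff bc_pplus_def bc_pminus_def bc_plus_def bc_minus_def bc_ops_defs
      field_simps)

lemma bc_components_eq_iff: "w = v \<longleftrightarrow> bc_plus w = bc_plus v \<and> bc_minus w = bc_minus v"
  using bc_decomposition by metis

lemma bc_components_simps [simp]:
  "bc_plus 0 = 0" "bc_minus 0 = 0"
  "bc_plus 1 = 1" "bc_minus 1 = 1"
  "bc_plus (w + v) = bc_plus w + bc_plus v" "bc_minus (w + v) = bc_minus w + bc_minus v"
  "bc_plus (w - v) = bc_plus w - bc_plus v" "bc_minus (w - v) = bc_minus w - bc_minus v"
  "bc_plus (- w) = - bc_plus w" "bc_minus (- w) = - bc_minus w"
  "bc_plus (w * v) = bc_plus w * bc_plus v" "bc_minus (w * v) = bc_minus w * bc_minus v"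
  "bc_plus (bc_of_complex z) = z" "bc_minus (bc_of_complex z) = z"
  "bc_plus bc_j = - \<i>" "bc_minus bc_j = \<i>"
  by (simp_all add: bc_plus_def bc_minus_def bc_ops_defs algebra_simps)

lemma bc_idempotent_components [simp]:
  "bc_plus bc_pplus = 1" "bc_minus bc_pplus = 0"
  "bc_plus bc_pminus = 0" "bc_minus bc_pminus = 1"
  by (simp_all add: bc_pplus_def bc_pminus_def)

lemma bc_idempotents:
  "bc_pplus * bc_pplus = bc_pplus" "bc_pminus * bc_pminus = bc_pminus"
  "bc_pplus * bc_pminus = 0"
  by (simp_all add: bc_components_eq_iff)

instantiation bicomplex :: real_algebra_1
begin

definition scaleR_bicomplex :: "real \<Rightarrow> bicomplex \<Rightarrow> bicomplex" where
  "r *\<^sub>R w = Bicomplex (r *\<^sub>R bc_fst w) (r *\<^sub>R bc_snd w)"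

instance
  by standard
     (simp_all add: bicomplex_eq_iff bc_ops_defs scaleR_bicomplex_def algebra_simps)

end

lemma bc_components_scaleR [simp]:
  "bc_plus (r *\<^sub>R w) = r *\<^sub>R bc_plus w" "bc_minus (r *\<^sub>R w) = r *\<^sub>R bc_minus w"
  by (simp_all add: bc_plus_def bc_minus_def scaleR_bicomplex_def scaleR_diff_right
      scaleR_add_right)

text \<open>The norm is submultiplicative only up to the factor \<open>sqrt 2\<close>, so there is no instance of
  \<open>real_normed_algebra\<close>.\<close>

instantiation bicomplex :: real_inner
begin

definition norm_bicomplex :: "bicomplex \<Rightarrow> real" where
  "norm w = sqrt (((cmod (bc_plus w))\<^sup>2 + (cmod (bc_minus w))\<^sup>2) / 2)"

definition inner_bicomplex :: "bicomplex \<Rightarrow> bicomplex \<Rightarrow> real" where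
  "w \<bullet> v = (bc_plus w \<bullet> bc_plus v + bc_minus w \<bullet> bc_minus v) / 2"

definition sgn_bicomplex_def: "sgn (w :: bicomplex) = w /\<^sub>R norm w"

definition dist_bicomplex_def: "dist (w :: bicomplex) v = norm (w - v)"

definition uniformity_bicomplex [code del]:
  "(uniformity :: (bicomplex \<times> bicomplex) filter) =
     (INF e\<in>{0<..}. principal {(w, v). dist w v < e})"

definition open_bicomplex [code del]:
  "open (U :: bicomplex set) \<longleftrightarrow>
     (\<forall>w\<in>U. eventually (\<lambda>(w', v). w' = w \<longrightarrow> v \<in> U) uniformity)"

instance
proof
  fix w v u :: bicomplex and r :: real
  show "w \<bullet> v = v \<bullet> w"
    by (simp add: inner_bicomplex_def inner_commute)
  show "(w + v) \<bullet> u = w \<bullet> u + v \<bullet> u"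
    by (simp add: inner_bicomplex_def inner_add_left add_divide_distrib)
  show "(r *\<^sub>R w) \<bullet> v = r * (w \<bullet> v)"
    by (simp add: inner_bicomplex_def distrib_left)
  show "0 \<le> w \<bullet> w"
    by (simp add: inner_bicomplex_def)
  show "w \<bullet> w = 0 \<longleftrightarrow> w = 0"
    by (simp add: inner_bicomplex_def add_nonneg_eq_0_iff bc_components_eq_iff)
  show "norm w = sqrt (w \<bullet> w)"
    by (simp add: inner_bicomplex_def norm_bicomplex_def power2_norm_eq_inner)
qed (rule sgn_bicomplex_def dist_bicomplex_def open_bicomplex uniformity_bicomplex)+

end

lemma inner_bicomplex_eq: "w \<bullet> v = bc_fst w \<bullet> bc_fst v + bc_snd w \<bullet> bc_snd v"
  by (simp add: inner_bicomplex_def bc_plus_def bc_minus_def inner_complex_def algebra_simps)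

instantiation bicomplex :: euclidean_space
begin

definition Basis_bicomplex :: "bicomplex set" where
  "Basis = {Bicomplex 1 0, Bicomplex \<i> 0, Bicomplex 0 1, Bicomplex 0 \<i>}"

instance
proof
  fix u v :: bicomplex
  assume "u \<in> Basis" "v \<in> Basis"
  then show "u \<bullet> v = (if u = v then 1 else 0)"
    unfolding Basis_bicomplex_def inner_bicomplex_eq inner_complex_def
    by (elim insertE emptyE) simp_all
next
  fix w :: bicomplex
  show "(\<forall>u\<in>Basis. w \<bullet> u = 0) \<longleftrightarrow> w = 0"
    unfolding bicomplex_eq_iff[of w] complex_eq_iff
    by (simp add: Basis_bicomplex_def inner_bicomplex_eq inner_complex_def zero_bicomplex_def)
qed (simp_all add: Basis_bicomplex_def)

end

lemma norm_bc_plus_le: "cmod (bc_plus w) \<le> norm w * sqrt 2"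
  unfolding norm_bicomplex_def real_sqrt_mult[symmetric] by (rule real_le_rsqrt) simp

lemma norm_bc_minus_le: "cmod (bc_minus w) \<le> norm w * sqrt 2"
  unfolding norm_bicomplex_def real_sqrt_mult[symmetric] by (rule real_le_rsqrt) simp

lemma bounded_linear_bc_plus: "bounded_linear bc_plus"
  using norm_bc_plus_le by (intro bounded_linear_intro) auto

lemma bounded_linear_bc_minus: "bounded_linear bc_minus"
  using norm_bc_minus_le by (intro bounded_linear_intro) auto


section \<open>Bicomplex holomorphic functions on the unit disk\<close>

text \<open>\<open>\<partial>\<^sub>x f\<close> and \<open>\<partial>\<^sub>y f\<close> are the values of the real Frechet derivative in the directions \<open>1\<close> and
  \<open>\<i>\<close>.\<close>

definition bc_dbar :: "(complex \<Rightarrow> bicomplex) \<Rightarrow> complex \<Rightarrow> bicomplex" where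
  "bc_dbar f z =
     (1/2) *\<^sub>R (frechet_derivative f (at z) 1 + bc_j * frechet_derivative f (at z) \<i>)"

text \<open>Functions on the disk are represented by total functions; the values outside the disk
  are irrelevant.\<close>

definition bc_Hol :: "(complex \<Rightarrow> bicomplex) set" where
  "bc_Hol = {f. \<forall>z\<in>ball 0 1. f differentiable (at z) \<and> bc_dbar f z = 0}"

lemma real_linear_complex_linear:
  assumes "bounded_linear (h :: complex \<Rightarrow> complex)" "h \<i> = \<i> * h 1"
  shows "h = (*) (h 1)"
proof
  fix w
  interpret bounded_linear h by fact
  have "w = Re w *\<^sub>R 1 + Im w *\<^sub>R \<i>"
    by (simp add: complex_eq_iff)
  then have "h w = h (Re w *\<^sub>R 1 + Im w *\<^sub>R \<i>)"
    by (rule arg_cong)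
  also have "\<dots> = Re w *\<^sub>R h 1 + Im w *\<^sub>R (\<i> * h 1)"
    by (simp only: add scaleR assms(2))
  also have "\<dots> = h 1 * w"
    by (simp add: complex_eq_iff algebra_simps)
  finally show "h w = h 1 * w" .
qed

lemma bc_Hol_iff:
  "f \<in> bc_Hol \<longleftrightarrow>
     (\<lambda>z. cnj (bc_plus (f z))) holomorphic_on ball 0 1 \<and> (\<lambda>z. bc_minus (f z)) holomorphic_on ball 0 1"
proof
  assume f: "f \<in> bc_Hol"
  have "(\<lambda>z. cnj (bc_plus (f z))) field_differentiable at z \<and>
        (\<lambda>z. bc_minus (f z)) field_differentiable at z" if z: "z \<in> ball 0 1" for z
  proof -
    define f' where "f' = frechet_derivative f (at z)"
    have f': "(f has_derivative f') (at z)"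
      using f z by (simp add: bc_Hol_def f'_def frechet_derivative_works)
    have "bc_dbar f z = 0"
      using f z by (simp add: bc_Hol_def)
    then have CR: "f' 1 + bc_j * f' \<i> = 0"
      by (simp add: bc_dbar_def f'_def)
    have "bc_plus (f' 1 + bc_j * f' \<i>) = 0" "bc_minus (f' 1 + bc_j * f' \<i>) = 0"
      by (simp_all only: CR bc_components_simps)
    then have p: "bc_plus (f' 1) = \<i> * bc_plus (f' \<i>)"
      and m: "bc_minus (f' 1) = - \<i> * bc_minus (f' \<i>)"
      by (simp_all add: eq_neg_iff_add_eq_0)
    have dp: "((\<lambda>z. cnj (bc_plus (f z))) has_derivative (\<lambda>w. cnj (bc_plus (f' w)))) (at z)"
      by (intro bounded_linear.has_derivative[OF bounded_linear_cnj]
          bounded_linear.has_derivative[OF bounded_linear_bc_plus] f')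
    have dm: "((\<lambda>z. bc_minus (f z)) has_derivative (\<lambda>w. bc_minus (f' w))) (at z)"
      by (intro bounded_linear.has_derivative[OF bounded_linear_bc_minus] f')
    have "(\<lambda>w. cnj (bc_plus (f' w))) = (*) (cnj (bc_plus (f' 1)))"
      by (rule real_linear_complex_linear[OF has_derivative_bounded_linear[OF dp]])
         (simp add: p flip: mult.assoc)
    moreover have "(\<lambda>w. bc_minus (f' w)) = (*) (bc_minus (f' 1))"
      by (rule real_linear_complex_linear[OF has_derivative_bounded_linear[OF dm]])
         (simp add: m flip: mult.assoc)
    ultimately show ?thesis
      using dp dm unfolding field_differentiable_def has_field_derivative_def by metis
  qed
  then show "(\<lambda>z. cnj (bc_plus (f z))) holomorphic_on ball 0 1 \<and>
      (\<lambda>z. bc_minus (f z)) holomorphic_on ball 0 1"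
    unfolding holomorphic_on_def using field_differentiable_at_within by blast
next
  assume h: "(\<lambda>z. cnj (bc_plus (f z))) holomorphic_on ball 0 1 \<and>
      (\<lambda>z. bc_minus (f z)) holomorphic_on ball 0 1"
  have "f differentiable (at z) \<and> bc_dbar f z = 0" if z: "z \<in> ball 0 1" for z
  proof -
    obtain a where a: "((\<lambda>z. cnj (bc_plus (f z))) has_derivative (*) a) (at z)"
      using h z by (metis holomorphic_on_imp_differentiable_at open_ball field_differentiable_def
          has_field_derivative_def)
    obtain b where b: "((\<lambda>z. bc_minus (f z)) has_derivative (*) b) (at z)"
      using h z by (metis holomorphic_on_imp_differentiable_at open_ball field_differentiable_def
          has_field_derivative_def)
    define E where "E x y = bc_pplus * bc_of_complex (cnj x) + bc_pminus * bc_of_complex y"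
      for x y
    have bl: "bounded_linear (\<lambda>x. E (fst x) (snd x))"
      by (intro linear_conv_bounded_linear[THEN iffD1] linearI)
         (simp_all add: E_def bc_components_eq_iff)
    have fE: "f = (\<lambda>z. E (cnj (bc_plus (f z))) (bc_minus (f z)))"
      by (rule ext) (simp add: E_def bc_components_eq_iff)
    have "((\<lambda>z. E (cnj (bc_plus (f z))) (bc_minus (f z))) has_derivative (\<lambda>w. E (a * w) (b * w)))
        (at z)"
      using bounded_linear.has_derivative[OF bl has_derivative_Pair[OF a b]] by simp
    then have d: "(f has_derivative (\<lambda>w. E (a * w) (b * w))) (at z)"
      using fE by metis
    then have "frechet_derivative f (at z) = (\<lambda>w. E (a * w) (b * w))"
      by (metis frechet_derivative_at)
    then have "bc_dbar f z = 0"
      by (simp add: bc_dbar_def bc_components_eq_iff E_def mult.left_commute[of \<i>])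
    with d show ?thesis
      unfolding differentiable_def by blast
  qed
  then show "f \<in> bc_Hol"
    by (simp add: bc_Hol_def)
qed


section \<open>Test functions and distributions on the unit circle\<close>

definition nth_vderiv :: "nat \<Rightarrow> (real \<Rightarrow> complex) \<Rightarrow> real \<Rightarrow> complex" where
  "nth_vderiv k = ((\<lambda>g \<theta>. vector_derivative g (at \<theta>)) ^^ k)"

definition circle_Cinf :: "(real \<Rightarrow> complex) set" where
  "circle_Cinf = {\<phi>. (\<forall>\<theta>. \<phi> (\<theta> + 2 * pi) = \<phi> \<theta>) \<and>
                     (\<forall>k \<theta>. nth_vderiv k \<phi> differentiable (at \<theta>))}"

definition circle_seminorm :: "nat \<Rightarrow> (real \<Rightarrow> complex) \<Rightarrow> real" where
  "circle_seminorm k \<phi> = (SUP \<theta>\<in>{0..2*pi}. cmod (nth_vderiv k \<phi> \<theta>))"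

text \<open>The Frechet topology of uniform convergence of all derivatives.\<close>

definition circle_Cinf_open :: "(real \<Rightarrow> complex) set \<Rightarrow> bool" where
  "circle_Cinf_open U \<longleftrightarrow>
     U \<subseteq> circle_Cinf \<and>
     (\<forall>\<phi>\<in>U. \<exists>N. \<exists>\<epsilon>>0. \<forall>\<psi>\<in>circle_Cinf.
        (\<forall>k\<le>N. circle_seminorm k (\<lambda>\<theta>. \<psi> \<theta> - \<phi> \<theta>) < \<epsilon>) \<longrightarrow> \<psi> \<in> U)"

definition circle_Cinf_topology :: "(real \<Rightarrow> complex) topology" where
  "circle_Cinf_topology = topology circle_Cinf_open"

text \<open>A distribution is represented by a functional on all functions, of which only the
  restriction to \<open>circle_Cinf\<close> matters.\<close>

definition circle_distributions :: "((real \<Rightarrow> complex) \<Rightarrow> complex) set" where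
  "circle_distributions =
     {u. (\<forall>\<phi>\<in>circle_Cinf. \<forall>\<psi>\<in>circle_Cinf. u (\<lambda>\<theta>. \<phi> \<theta> + \<psi> \<theta>) = u \<phi> + u \<psi>) \<and>
         (\<forall>c. \<forall>\<phi>\<in>circle_Cinf. u (\<lambda>\<theta>. c * \<phi> \<theta>) = c * u \<phi>) \<and>
         continuous_map circle_Cinf_topology euclidean u}"

definition conj_distribution ::
    "((real \<Rightarrow> complex) \<Rightarrow> complex) \<Rightarrow> (real \<Rightarrow> complex) \<Rightarrow> complex" where
  "conj_distribution u \<phi> = cnj (u (\<lambda>\<theta>. cnj (\<phi> \<theta>)))"

text \<open>A bicomplex-valued distribution \<open>T = p\<^sup>+ T\<^sup>+ + p\<^sup>- T\<^sup>-\<close>, acting on complex test functions, is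
  given by its two components \<open>T\<^sup>+ = bc_plus \<circ> T\<close> and \<open>T\<^sup>- = bc_minus \<circ> T\<close>.\<close>

definition bc_circle_distributions :: "((real \<Rightarrow> complex) \<Rightarrow> bicomplex) set" where
  "bc_circle_distributions =
     {T. bc_plus \<circ> T \<in> circle_distributions \<and> bc_minus \<circ> T \<in> circle_distributions}"

definition poisson_kernel :: "real \<Rightarrow> real \<Rightarrow> real" where
  "poisson_kernel r \<theta> = (1 - r\<^sup>2) / (1 - 2 * r * cos \<theta> + r\<^sup>2)"

lemma istopology_circle_Cinf_open: "istopology circle_Cinf_open"
  unfolding istopology_def
proof (intro conjI allI impI)
  fix S T assume S: "circle_Cinf_open S" and T: "circle_Cinf_open T"
  show "circle_Cinf_open (S \<inter> T)"
    unfolding circle_Cinf_open_def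
  proof (intro conjI ballI)
    show "S \<inter> T \<subseteq> circle_Cinf"
      using S by (auto simp: circle_Cinf_open_def)
    fix \<phi> assume "\<phi> \<in> S \<inter> T"
    then have "\<phi> \<in> S" "\<phi> \<in> T"
      by auto
    obtain N \<epsilon> where N: "\<epsilon> > 0" "\<forall>\<psi>\<in>circle_Cinf.
        (\<forall>k\<le>N. circle_seminorm k (\<lambda>\<theta>. \<psi> \<theta> - \<phi> \<theta>) < \<epsilon>) \<longrightarrow> \<psi> \<in> S"
      using S \<open>\<phi> \<in> S\<close> unfolding circle_Cinf_open_def by blast
    obtain M \<delta> where M: "\<delta> > 0" "\<forall>\<psi>\<in>circle_Cinf.
        (\<forall>k\<le>M. circle_seminorm k (\<lambda>\<theta>. \<psi> \<theta> - \<phi> \<theta>) < \<delta>) \<longrightarrow> \<psi> \<in> T"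
      using T \<open>\<phi> \<in> T\<close> unfolding circle_Cinf_open_def by blast
    show "\<exists>N. \<exists>\<epsilon>>0. \<forall>\<psi>\<in>circle_Cinf.
        (\<forall>k\<le>N. circle_seminorm k (\<lambda>\<theta>. \<psi> \<theta> - \<phi> \<theta>) < \<epsilon>) \<longrightarrow> \<psi> \<in> S \<inter> T"
      by (rule exI[of _ "max N M"], rule exI[of _ "min \<epsilon> \<delta>"]) (use N M in auto)
  qed
next
  fix K assume K: "\<forall>S\<in>K. circle_Cinf_open S"
  show "circle_Cinf_open (\<Union>K)"
    unfolding circle_Cinf_open_def
  proof (intro conjI ballI)
    show "\<Union>K \<subseteq> circle_Cinf"
      using K by (auto simp: circle_Cinf_open_def)
    fix \<phi> assume "\<phi> \<in> \<Union>K"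
    then obtain S where S: "S \<in> K" "\<phi> \<in> S"
      by blast
    then obtain N \<epsilon> where "\<epsilon> > 0" "\<forall>\<psi>\<in>circle_Cinf.
        (\<forall>k\<le>N. circle_seminorm k (\<lambda>\<theta>. \<psi> \<theta> - \<phi> \<theta>) < \<epsilon>) \<longrightarrow> \<psi> \<in> S"
      using K unfolding circle_Cinf_open_def by blast
    with S show "\<exists>N. \<exists>\<epsilon>>0. \<forall>\<psi>\<in>circle_Cinf.
        (\<forall>k\<le>N. circle_seminorm k (\<lambda>\<theta>. \<psi> \<theta> - \<phi> \<theta>) < \<epsilon>) \<longrightarrow> \<psi> \<in> \<Union>K"
      by blast
  qed
qed

lemma openin_circle_Cinf_topology: "openin circle_Cinf_topology U \<longleftrightarrow> circle_Cinf_open U"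
  by (simp add: circle_Cinf_topology_def topology_inverse' istopology_circle_Cinf_open)

lemma topspace_circle_Cinf_topology [simp]: "topspace circle_Cinf_topology = circle_Cinf"
proof -
  have "circle_Cinf_open circle_Cinf"
    unfolding circle_Cinf_open_def by (metis order_refl zero_less_one)
  then show ?thesis
    by (auto simp: topspace_def openin_circle_Cinf_topology circle_Cinf_open_def)
qed

lemma nth_vderiv_0 [simp]: "nth_vderiv 0 \<phi> = \<phi>"
  by (simp add: nth_vderiv_def)

lemma nth_vderiv_Suc: "nth_vderiv (Suc k) \<phi> \<theta> = vector_derivative (nth_vderiv k \<phi>) (at \<theta>)"
  by (simp add: nth_vderiv_def)

lemma nth_vderiv_cmult:
  assumes "\<phi> \<in> circle_Cinf"
  shows "nth_vderiv k (\<lambda>\<theta>. c * \<phi> \<theta>) = (\<lambda>\<theta>. c * nth_vderiv k \<phi> \<theta>)"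
proof (induction k)
  case (Suc k)
  show ?case
  proof
    fix \<theta>
    have "(nth_vderiv k \<phi> has_vector_derivative nth_vderiv (Suc k) \<phi> \<theta>) (at \<theta>)"
      using assms by (simp add: nth_vderiv_Suc circle_Cinf_def flip: vector_derivative_works)
    then have "((\<lambda>\<theta>. c * nth_vderiv k \<phi> \<theta>) has_vector_derivative c * nth_vderiv (Suc k) \<phi> \<theta>) (at \<theta>)"
      by (rule has_vector_derivative_mult_right)
    then show "nth_vderiv (Suc k) (\<lambda>\<theta>. c * \<phi> \<theta>) \<theta> = c * nth_vderiv (Suc k) \<phi> \<theta>"
      by (simp add: nth_vderiv_Suc[of _ "\<lambda>\<theta>. c * \<phi> \<theta>"] Suc vector_derivative_at)
  qed
qed simp

lemma nth_vderiv_add: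
  assumes "\<phi> \<in> circle_Cinf" "\<psi> \<in> circle_Cinf"
  shows "nth_vderiv k (\<lambda>\<theta>. \<phi> \<theta> + \<psi> \<theta>) = (\<lambda>\<theta>. nth_vderiv k \<phi> \<theta> + nth_vderiv k \<psi> \<theta>)"
proof (induction k)
  case (Suc k)
  show ?case
  proof
    fix \<theta>
    have "(nth_vderiv k \<phi> has_vector_derivative nth_vderiv (Suc k) \<phi> \<theta>) (at \<theta>)"
         "(nth_vderiv k \<psi> has_vector_derivative nth_vderiv (Suc k) \<psi> \<theta>) (at \<theta>)"
      using assms by (simp_all add: nth_vderiv_Suc circle_Cinf_def flip: vector_derivative_works)
    then have "((\<lambda>\<theta>. nth_vderiv k \<phi> \<theta> + nth_vderiv k \<psi> \<theta>) has_vector_derivative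
        nth_vderiv (Suc k) \<phi> \<theta> + nth_vderiv (Suc k) \<psi> \<theta>) (at \<theta>)"
      by (rule has_vector_derivative_add)
    then show "nth_vderiv (Suc k) (\<lambda>\<theta>. \<phi> \<theta> + \<psi> \<theta>) \<theta> =
        nth_vderiv (Suc k) \<phi> \<theta> + nth_vderiv (Suc k) \<psi> \<theta>"
      by (simp add: nth_vderiv_Suc[of _ "\<lambda>\<theta>. \<phi> \<theta> + \<psi> \<theta>"] Suc vector_derivative_at)
  qed
qed simp

lemma circle_Cinf_cmult:
  assumes "\<phi> \<in> circle_Cinf"
  shows "(\<lambda>\<theta>. c * \<phi> \<theta>) \<in> circle_Cinf"
  using assms nth_vderiv_cmult[OF assms]
  by (auto simp: circle_Cinf_def intro!: differentiable_mult)

lemma circle_Cinf_add: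
  assumes "\<phi> \<in> circle_Cinf" "\<psi> \<in> circle_Cinf"
  shows "(\<lambda>\<theta>. \<phi> \<theta> + \<psi> \<theta>) \<in> circle_Cinf"
  using assms nth_vderiv_add[OF assms]
  by (auto simp: circle_Cinf_def intro!: differentiable_add)

lemma circle_Cinf_diff:
  assumes "\<phi> \<in> circle_Cinf" "\<psi> \<in> circle_Cinf"
  shows "(\<lambda>\<theta>. \<phi> \<theta> - \<psi> \<theta>) \<in> circle_Cinf"
  using circle_Cinf_add[OF assms(1) circle_Cinf_cmult[OF assms(2), of "-1"]] by simp

lemma norm_nth_vderiv_le_seminorm:
  assumes "\<phi> \<in> circle_Cinf" "\<theta> \<in> {0..2*pi}"
  shows "cmod (nth_vderiv k \<phi> \<theta>) \<le> circle_seminorm k \<phi>"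
proof -
  have "continuous_on {0..2*pi} (\<lambda>\<theta>. cmod (nth_vderiv k \<phi> \<theta>))"
    using assms(1) by (intro continuous_on_norm continuous_at_imp_continuous_on)
      (auto simp: circle_Cinf_def intro: differentiable_imp_continuous_within)
  then have "bdd_above ((\<lambda>\<theta>. cmod (nth_vderiv k \<phi> \<theta>)) ` {0..2*pi})"
    by (intro bounded_imp_bdd_above compact_imp_bounded compact_continuous_image) auto
  with assms(2) show ?thesis
    unfolding circle_seminorm_def by (rule cSUP_upper)
qed

lemma circle_seminorm_nonneg:
  assumes "\<phi> \<in> circle_Cinf"
  shows "0 \<le> circle_seminorm k \<phi>"
  by (rule order_trans[OF norm_ge_zero norm_nth_vderiv_le_seminorm[OF assms, of 0]]) simp

lemma circle_seminorm_cmult_le: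
  assumes "\<phi> \<in> circle_Cinf"
  shows "circle_seminorm k (\<lambda>\<theta>. c * \<phi> \<theta>) \<le> cmod c * circle_seminorm k \<phi>"
proof -
  have "(SUP \<theta>\<in>{0..2*pi}. cmod (c * nth_vderiv k \<phi> \<theta>)) \<le> cmod c * circle_seminorm k \<phi>"
  proof (rule cSUP_least)
    fix \<theta> :: real assume "\<theta> \<in> {0..2*pi}"
    then show "cmod (c * nth_vderiv k \<phi> \<theta>) \<le> cmod c * circle_seminorm k \<phi>"
      unfolding norm_mult by (intro mult_left_mono norm_nth_vderiv_le_seminorm assms) auto
  qed simp
  then show ?thesis
    unfolding circle_seminorm_def[of k "\<lambda>\<theta>. c * \<phi> \<theta>"] nth_vderiv_cmult[OF assms] .
qed

text \<open>The usual criterion: continuity of a linear functional amounts to an estimate by finitely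
  many seminorms.\<close>

lemma circle_distributions_iff:
  "u \<in> circle_distributions \<longleftrightarrow>
     (\<forall>\<phi>\<in>circle_Cinf. \<forall>\<psi>\<in>circle_Cinf. u (\<lambda>\<theta>. \<phi> \<theta> + \<psi> \<theta>) = u \<phi> + u \<psi>) \<and>
     (\<forall>c. \<forall>\<phi>\<in>circle_Cinf. u (\<lambda>\<theta>. c * \<phi> \<theta>) = c * u \<phi>) \<and>
     (\<exists>C\<ge>0. \<exists>N. \<forall>\<phi>\<in>circle_Cinf. cmod (u \<phi>) \<le> C * (\<Sum>k\<le>N. circle_seminorm k \<phi>))"
proof -
  have "continuous_map circle_Cinf_topology euclidean u \<longleftrightarrow>
     (\<exists>C\<ge>0. \<exists>N. \<forall>\<phi>\<in>circle_Cinf. cmod (u \<phi>) \<le> C * (\<Sum>k\<le>N. circle_seminorm k \<phi>))" (is "?L \<longleftrightarrow> ?R")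
    if add: "\<forall>\<phi>\<in>circle_Cinf. \<forall>\<psi>\<in>circle_Cinf. u (\<lambda>\<theta>. \<phi> \<theta> + \<psi> \<theta>) = u \<phi> + u \<psi>"
      and cmult: "\<forall>c. \<forall>\<phi>\<in>circle_Cinf. u (\<lambda>\<theta>. c * \<phi> \<theta>) = c * u \<phi>"
  proof
    have zero: "(\<lambda>_. 0) \<in> circle_Cinf"
    proof -
      have "nth_vderiv k (\<lambda>_. 0) = (\<lambda>_. 0)" for k
      proof (induction k)
        case (Suc k)
        then show ?case
          by (intro ext) (simp only: nth_vderiv_Suc vector_derivative_const_at)
      qed simp
      then show ?thesis
        by (simp add: circle_Cinf_def)
    qed
    have u0: "u (\<lambda>_. 0) = 0"
      using cmult[rule_format, of "\<lambda>_. 0" 0] zero by simp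
    assume ?L
    then have "\<forall>V. open V \<longrightarrow> circle_Cinf_open {\<phi> \<in> circle_Cinf. u \<phi> \<in> V}"
      by (simp add: continuous_map openin_circle_Cinf_topology)
    then have op: "circle_Cinf_open {\<phi> \<in> circle_Cinf. u \<phi> \<in> ball 0 1}"
      using open_ball by blast
    have mem: "(\<lambda>_. 0) \<in> {\<phi> \<in> circle_Cinf. u \<phi> \<in> ball 0 1}"
      using zero u0 by simp
    obtain N \<epsilon> where \<epsilon>: "\<epsilon> > 0" and
      N: "\<forall>\<psi>\<in>circle_Cinf. (\<forall>k\<le>N. circle_seminorm k (\<lambda>\<theta>. \<psi> \<theta> - 0) < \<epsilon>) \<longrightarrow>
           \<psi> \<in> {\<phi> \<in> circle_Cinf. u \<phi> \<in> ball 0 1}"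
      using bspec[OF conjunct2[OF op[unfolded circle_Cinf_open_def]] mem] by (elim exE conjE)
    have "cmod (u \<phi>) \<le> (1 / \<epsilon>) * (\<Sum>k\<le>N. circle_seminorm k \<phi>)" if \<phi>: "\<phi> \<in> circle_Cinf" for \<phi>
    proof -
      define S where "S = (\<Sum>k\<le>N. circle_seminorm k \<phi>)"
      have S: "S \<ge> 0"
        unfolding S_def by (intro sum_nonneg circle_seminorm_nonneg \<phi>)
      have "\<epsilon> * cmod (u \<phi>) \<le> S"
      proof (rule dense_ge)
        fix T assume T: "S < T"
        with S have T0: "T > 0" by linarith
        let ?c = "complex_of_real (\<epsilon> / T)"
        have "circle_seminorm k (\<lambda>\<theta>. ?c * \<phi> \<theta>) < \<epsilon>" if "k \<le> N" for k
        proof -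
          have "circle_seminorm k \<phi> \<le> S"
            unfolding S_def by (rule member_le_sum) (use that circle_seminorm_nonneg \<phi> in auto)
          then have "\<epsilon> / T * circle_seminorm k \<phi> < \<epsilon> / T * T"
            using \<epsilon> T T0 by (intro mult_strict_left_mono) auto
          moreover have "circle_seminorm k (\<lambda>\<theta>. ?c * \<phi> \<theta>) \<le> \<epsilon> / T * circle_seminorm k \<phi>"
            using circle_seminorm_cmult_le[OF \<phi>, of k ?c] \<epsilon> T0 by (simp del: of_real_divide)
          ultimately show ?thesis
            using T0 by simp
        qed
        then have "cmod (u (\<lambda>\<theta>. ?c * \<phi> \<theta>)) < 1"
          using N circle_Cinf_cmult[OF \<phi>, of ?c] by simp
        then have "\<epsilon> / T * cmod (u \<phi>) < 1"
          using cmult \<phi> \<epsilon> T0 by (simp add: norm_mult del: of_real_divide)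
        then show "\<epsilon> * cmod (u \<phi>) \<le> T"
          using T0 by (simp add: field_simps)
      qed
      then show ?thesis
        using \<epsilon> by (simp add: S_def field_simps)
    qed
    then show ?R
      using \<epsilon> by (intro exI[of _ "1 / \<epsilon>"]) auto
  next
    assume ?R
    then obtain C N where C: "C \<ge> 0" and
      N: "\<And>\<phi>. \<phi> \<in> circle_Cinf \<Longrightarrow> cmod (u \<phi>) \<le> C * (\<Sum>k\<le>N. circle_seminorm k \<phi>)"
      by blast
    have "circle_Cinf_open {\<phi> \<in> circle_Cinf. u \<phi> \<in> V}" if V: "open V" for V
      unfolding circle_Cinf_open_def
    proof (intro conjI ballI)
      fix \<phi> assume "\<phi> \<in> {\<phi> \<in> circle_Cinf. u \<phi> \<in> V}"
      then have \<phi>: "\<phi> \<in> circle_Cinf" "u \<phi> \<in> V" by auto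
      then obtain e where e: "e > 0" "ball (u \<phi>) e \<subseteq> V"
        using V openE by blast
      define \<epsilon> where "\<epsilon> = e / (C * (real N + 1) + 1)"
      have pos: "C * (real N + 1) + 1 > 0"
        using C by (simp add: add_nonneg_pos)
      then have \<epsilon>: "\<epsilon> > 0"
        using e by (simp add: \<epsilon>_def)
      have "\<psi> \<in> {\<phi> \<in> circle_Cinf. u \<phi> \<in> V}"
        if \<psi>: "\<psi> \<in> circle_Cinf" and
          small: "\<forall>k\<le>N. circle_seminorm k (\<lambda>\<theta>. \<psi> \<theta> - \<phi> \<theta>) < \<epsilon>" for \<psi>
      proof -
        have "u \<psi> = u (\<lambda>\<theta>. \<phi> \<theta> + (\<psi> \<theta> - \<phi> \<theta>))"
          by simp
        also have "\<dots> = u \<phi> + u (\<lambda>\<theta>. \<psi> \<theta> - \<phi> \<theta>)"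
          by (rule add[rule_format, OF \<phi>(1) circle_Cinf_diff[OF \<psi> \<phi>(1)]])
        finally have "dist (u \<phi>) (u \<psi>) = cmod (u (\<lambda>\<theta>. \<psi> \<theta> - \<phi> \<theta>))"
          by (simp add: dist_norm)
        also have "\<dots> \<le> C * (\<Sum>k\<le>N. circle_seminorm k (\<lambda>\<theta>. \<psi> \<theta> - \<phi> \<theta>))"
          by (rule N) (rule circle_Cinf_diff[OF \<psi> \<phi>(1)])
        also have "\<dots> \<le> C * (\<Sum>k\<le>N. \<epsilon>)"
          using small C by (intro mult_left_mono sum_mono) auto
        also have "\<dots> < (C * (real N + 1) + 1) * \<epsilon>"
          using \<epsilon> by (simp add: algebra_simps)
        also have "\<dots> = e"
          using pos by (simp add: \<epsilon>_def)
        finally show ?thesis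
          using e \<psi> by auto
      qed
      then show "\<exists>N. \<exists>\<epsilon>>0. \<forall>\<psi>\<in>circle_Cinf.
          (\<forall>k\<le>N. circle_seminorm k (\<lambda>\<theta>. \<psi> \<theta> - \<phi> \<theta>) < \<epsilon>) \<longrightarrow> \<psi> \<in> {\<phi> \<in> circle_Cinf. u \<phi> \<in> V}"
        by (intro exI[of _ N] exI[of _ \<epsilon>] conjI \<epsilon> ballI impI)
    qed (rule Collect_restrict)
    then show ?L
      by (simp add: continuous_map openin_circle_Cinf_topology)
  qed
  note * = this
  have conj_eq: "(P \<and> Q \<and> L) = (P \<and> Q \<and> R)" if "P \<Longrightarrow> Q \<Longrightarrow> L = R" for P Q L R
    using that by blast
  show ?thesis
    unfolding circle_distributions_def mem_Collect_eq by (rule conj_eq) (rule *)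
qed

end

theory Submission
  imports Defs
begin

text \<open>
  A bicomplex holomorphic function on the disk amounts to two ordinary holomorphic functions, the
  conjugate of its plus component and its minus component, and each of the three conditions splits
  accordingly into a condition on these two functions. So it suffices to compare the conditions for a
  single holomorphic \<open>h(z) = \<Sum>n. a n * z ^ n\<close>. For such an \<open>h\<close>, each of them is equivalent to
  polynomial growth of the Taylor coefficients \<open>a n\<close>.

  \<^item> Growth of the coefficients like \<open>(n + 1) ^ N\<close> bounds \<open>h\<close> by a multiple of
    \<open>\<Sum>n. (n + 1) ^ N * r ^ n \<le> N! / (1 - r) ^ (N + 1)\<close>. Conversely, the integral formula for \<open>a n\<close> on
    a circle at distance about \<open>1 / n\<close> from the boundary turns a bound \<open>C / (1 - r) ^ N\<close> into
    polynomial growth.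

  \<^item> The integrals of a test function \<open>\<phi>\<close> against \<open>cis (n * t)\<close> decrease faster than any power of \<open>n\<close>.
    For coefficients of polynomial growth, the series obtained by pairing \<open>h\<close> with \<open>\<phi>\<close> on the circle
    of radius \<open>r\<close> is therefore absolutely convergent up to \<open>r = 1\<close>. Its value there is the limit of
    the pairings (\<open>tendsto_boundary_functional\<close>), it depends on \<open>\<phi>\<close> as a distribution
    (\<open>boundary_functional_distribution\<close>), and its values on Poisson kernels return \<open>h\<close>
    (\<open>boundary_functional_poisson_at\<close>).

  \<^item> If the limits exist for all test functions, the coefficients grow polynomially: otherwise a
    lacunary test function built from the inverses of some very large coefficients makes the
    pairings diverge (\<open>polynomial_growth_if_limits\<close>).

  \<^item> If \<open>h\<close> is the Poisson integral of a distribution, that distribution is controlled by finitely many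
    seminorms, and the seminorms of the Poisson kernel are bounded by powers of \<open>1 / (1 - r)\<close>
    (\<open>norm_le_if_poisson_integral\<close>).
\<close>

section \<open>Test functions and distributions under conjugation and differentiation\<close>

lemma has_vector_derivative_cis_mult:
  fixes k t :: real
  shows "((\<lambda>t. cis (k * t)) has_vector_derivative \<i> * k * cis (k * t)) (at t)"
  unfolding has_vector_derivative_complex_iff
  by (auto intro!: derivative_eq_intros)

lemma circle_Cinf_has_vector_derivative:
  assumes "\<phi> \<in> circle_Cinf"
  shows "(nth_vderiv k \<phi> has_vector_derivative nth_vderiv (Suc k) \<phi> t) (at t)"
  using assms by (simp add: nth_vderiv_Suc circle_Cinf_def flip: vector_derivative_works)

lemma circle_Cinf_continuous_on:
  assumes "\<phi> \<in> circle_Cinf"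
  shows "continuous_on S (nth_vderiv k \<phi>)"
  using circle_Cinf_has_vector_derivative[OF assms]
  by (meson continuous_at_imp_continuous_on has_vector_derivative_continuous)

lemma nth_vderiv_periodic:
  assumes "\<phi> \<in> circle_Cinf"
  shows "nth_vderiv k \<phi> (t + 2 * pi) = nth_vderiv k \<phi> t"
proof (induction k arbitrary: t)
  case (Suc k)
  have "((\<lambda>t. nth_vderiv k \<phi> (t + 2 * pi)) has_vector_derivative
      1 *\<^sub>R nth_vderiv (Suc k) \<phi> (t + 2 * pi)) (at t)"
    by (rule vector_diff_chain_at[of "\<lambda>t. t + 2 * pi" 1 t "nth_vderiv k \<phi>", unfolded o_def])
       (auto intro!: derivative_eq_intros circle_Cinf_has_vector_derivative assms)
  then have "(nth_vderiv k \<phi> has_vector_derivative nth_vderiv (Suc k) \<phi> (t + 2 * pi)) (at t)"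
    by (simp add: Suc)
  then show ?case
    using vector_derivative_unique_at circle_Cinf_has_vector_derivative[OF assms] by blast
qed (use assms in \<open>simp add: circle_Cinf_def\<close>)

lemma nth_vderiv_cnj:
  assumes "\<phi> \<in> circle_Cinf"
  shows "nth_vderiv k (\<lambda>t. cnj (\<phi> t)) = (\<lambda>t. cnj (nth_vderiv k \<phi> t))"
proof (induction k)
  case (Suc k)
  show ?case
  proof
    fix t
    have "((\<lambda>t. cnj (nth_vderiv k \<phi> t)) has_vector_derivative cnj (nth_vderiv (Suc k) \<phi> t)) (at t)"
      by (intro has_vector_derivative_cnj circle_Cinf_has_vector_derivative assms)
    then show "nth_vderiv (Suc k) (\<lambda>t. cnj (\<phi> t)) t = cnj (nth_vderiv (Suc k) \<phi> t)"
      by (simp add: nth_vderiv_Suc[of _ "\<lambda>t. cnj (\<phi> t)"] Suc vector_derivative_at)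
  qed
qed simp

lemma circle_Cinf_cnj:
  assumes "\<phi> \<in> circle_Cinf"
  shows "(\<lambda>t. cnj (\<phi> t)) \<in> circle_Cinf"
  using assms nth_vderiv_cnj[OF assms] by (auto simp: circle_Cinf_def differentiable_cnj_iff)

lemma circle_seminorm_cnj:
  assumes "\<phi> \<in> circle_Cinf"
  shows "circle_seminorm k (\<lambda>t. cnj (\<phi> t)) = circle_seminorm k \<phi>"
  by (simp add: circle_seminorm_def nth_vderiv_cnj[OF assms])

lemma circle_distributions_conj:
  assumes "u \<in> circle_distributions"
  shows "conj_distribution u \<in> circle_distributions"
proof -
  have add: "\<And>\<phi> \<psi>. \<phi> \<in> circle_Cinf \<Longrightarrow> \<psi> \<in> circle_Cinf \<Longrightarrow> u (\<lambda>t. \<phi> t + \<psi> t) = u \<phi> + u \<psi>"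
    and cmult: "\<And>c \<phi>. \<phi> \<in> circle_Cinf \<Longrightarrow> u (\<lambda>t. c * \<phi> t) = c * u \<phi>"
    using assms unfolding circle_distributions_iff by blast+
  obtain C N where CN: "C \<ge> 0"
    "\<And>\<phi>. \<phi> \<in> circle_Cinf \<Longrightarrow> cmod (u \<phi>) \<le> C * (\<Sum>k\<le>N. circle_seminorm k \<phi>)"
    using assms unfolding circle_distributions_iff by blast
  show ?thesis
    unfolding circle_distributions_iff
  proof (intro conjI ballI allI)
    show "\<exists>C\<ge>0. \<exists>N. \<forall>\<phi>\<in>circle_Cinf.
        cmod (conj_distribution u \<phi>) \<le> C * (\<Sum>k\<le>N. circle_seminorm k \<phi>)"
      using CN(1) CN(2)[OF circle_Cinf_cnj]
      by (intro exI[of _ C] conjI exI[of _ N] ballI)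
         (auto simp: conj_distribution_def circle_seminorm_cnj)
  qed (simp_all add: conj_distribution_def add cmult circle_Cinf_cnj)
qed

section \<open>Moments of functions on the circle\<close>

text \<open>This is \<open>2 * pi\<close> times the Fourier coefficient of \<open>\<phi>\<close> at the frequency \<open>- n\<close>. With this
  sign, the moments at \<open>n \<ge> 0\<close> are exactly what the monomials \<open>z ^ n\<close> see on the circle.\<close>
definition circle_moment :: "int \<Rightarrow> (real \<Rightarrow> complex) \<Rightarrow> complex" where
  "circle_moment n \<phi> = integral {0..2*pi} (\<lambda>t. cis (real_of_int n * t) * \<phi> t)"

lemma circle_moment_integrable:
  assumes "continuous_on {0..2*pi} \<phi>"
  shows "(\<lambda>t. cis (real_of_int n * t) * \<phi> t) integrable_on {0..2*pi}"
  by (intro integrable_continuous_real continuous_intros assms)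

lemma circle_moment_add:
  assumes "continuous_on {0..2*pi} \<phi>" "continuous_on {0..2*pi} \<psi>"
  shows "circle_moment n (\<lambda>t. \<phi> t + \<psi> t) = circle_moment n \<phi> + circle_moment n \<psi>"
  unfolding circle_moment_def distrib_left
  by (intro integral_add circle_moment_integrable assms)

lemma circle_moment_cmult: "circle_moment n (\<lambda>t. c * \<phi> t) = c * circle_moment n \<phi>"
  by (simp add: circle_moment_def mult.left_commute[of _ c] integral_mult_right)

lemma circle_moment_cis:
  "circle_moment n (\<lambda>t. cis (real_of_int m * t)) = (if n + m = 0 then 2 * pi else 0)"
proof (cases "n + m = 0")
  case True
  then have "real_of_int n * t + real_of_int m * t = 0" for t
    by (simp flip: distrib_right of_int_add)
  then show ?thesis
    using True by (simp add: circle_moment_def cis_mult scaleR_conv_of_real)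
next
  case False
  define k where "k = real_of_int (n + m)"
  have k: "k \<noteq> 0" using False by (simp only: k_def of_int_eq_0_iff) simp
  have "((\<lambda>t. \<i> * k * cis (k * t)) has_integral cis (k * (2 * pi)) - cis (k * 0)) {0..2*pi}"
    by (intro fundamental_theorem_of_calculus)
       (auto intro: has_vector_derivative_cis_mult has_vector_derivative_at_within)
  moreover have "cis (k * (2 * pi)) = 1"
    using cis_multiple_2pi[of k] by (simp add: k_def mult_ac)
  ultimately have "((\<lambda>t. (\<i> * k) * cis (k * t)) has_integral 0) {0..2*pi}"
    by simp
  then have "((\<lambda>t. cis (k * t)) has_integral 0 / (\<i> * k)) {0..2*pi}"
    using k by (subst (asm) has_integral_mult_right_iff) auto
  then show ?thesis
    using False by (auto simp: circle_moment_def cis_mult k_def distrib_right intro!: integral_unique)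
qed

lemma norm_circle_moment_le:
  assumes "continuous_on {0..2*pi} \<phi>" "\<And>t. t \<in> {0..2*pi} \<Longrightarrow> cmod (\<phi> t) \<le> B"
  shows "cmod (circle_moment n \<phi>) \<le> 2 * pi * B"
proof -
  have "cmod (circle_moment n \<phi>) \<le> B * (2 * pi - 0)"
    unfolding circle_moment_def
    by (rule integral_bound; (intro continuous_intros assms(1))?) (simp_all add: norm_mult assms(2))
  then show ?thesis by (simp add: mult_ac)
qed

text \<open>Integration by parts: the function \<open>t \<mapsto> cis (n * t) * nth_vderiv k \<phi> t\<close> is periodic, so the
  integral of its derivative over a period vanishes, which relates the moments of two consecutive
  derivatives.\<close>
lemma circle_moment_nth_vderiv:
  assumes "\<phi> \<in> circle_Cinf"
  shows "circle_moment n (nth_vderiv k \<phi>) = (- \<i> * of_int n) ^ k * circle_moment n \<phi>"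
proof (induction k)
  case (Suc k)
  define e :: "real \<Rightarrow> complex" where "e t = cis (real_of_int n * t)" for t
  define g where "g = nth_vderiv k \<phi>"
  define g' where "g' = nth_vderiv (Suc k) \<phi>"
  have e: "(e has_vector_derivative \<i> * of_int n * e t) (at t)" for t
    using has_vector_derivative_cis_mult[of "real_of_int n" t] by (simp add: e_def[abs_def])
  have g: "(g has_vector_derivative g' t) (at t)" for t
    unfolding g_def g'_def by (rule circle_Cinf_has_vector_derivative[OF assms])
  have "((\<lambda>t. e t * g' t + \<i> * of_int n * e t * g t) has_integral
      e (2 * pi) * g (2 * pi) - e 0 * g 0) {0..2*pi}"
    by (rule fundamental_theorem_of_calculus, simp)
       (rule has_vector_derivative_at_within[OF has_vector_derivative_mult[OF e g]])
  moreover have "g (2 * pi) = g 0"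
    using nth_vderiv_periodic[OF assms, of k 0] by (simp add: g_def)
  moreover have "e (2 * pi) = 1"
    using cis_multiple_2pi[of "real_of_int n"] by (simp add: e_def mult.commute)
  moreover have "e 0 = 1"
    by (simp add: e_def)
  ultimately have "((\<lambda>t. e t * g' t + \<i> * of_int n * (e t * g t)) has_integral 0) {0..2*pi}"
    by (simp add: mult.assoc)
  moreover have "((\<lambda>t. e t * g' t + \<i> * of_int n * (e t * g t)) has_integral
      circle_moment n g' + \<i> * of_int n * circle_moment n g) {0..2*pi}"
    unfolding circle_moment_def e_def g_def g'_def
    by (intro has_integral_add has_integral_mult_right integrable_integral
        circle_moment_integrable circle_Cinf_continuous_on assms)
  ultimately have "circle_moment n g' + \<i> * of_int n * circle_moment n g = 0"
    using has_integral_unique by blast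
  then show ?case
    unfolding g'_def g_def Suc power_Suc by (simp add: eq_neg_iff_add_eq_0 mult.assoc)
qed simp

text \<open>The moments of a test function decrease faster than any power of the frequency. The weight
  \<open>n + 1\<close> instead of \<open>n\<close> makes the bound informative at \<open>n = 0\<close> too; it is expanded by the binomial
  theorem, and each power \<open>n ^ k\<close> is absorbed by the \<open>k\<close>-th derivative.\<close>
lemma circle_moment_decay:
  assumes "\<phi> \<in> circle_Cinf"
  shows "cmod (circle_moment (int n) \<phi>) * (real n + 1) ^ m
    \<le> 2 * pi * 2 ^ m * (\<Sum>k\<le>m. circle_seminorm k \<phi>)"
proof -
  have moment: "cmod (circle_moment (int n) \<phi>) * real n ^ k \<le> 2 * pi * circle_seminorm k \<phi>" for k
    using norm_circle_moment_le[OF circle_Cinf_continuous_on[OF assms]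
        norm_nth_vderiv_le_seminorm[OF assms, of _ k], of "int n"]
    by (simp add: circle_moment_nth_vderiv[OF assms] norm_mult norm_power mult.commute)
  have *: "cmod (circle_moment (int n) \<phi>) * (real (m choose k) * real n ^ k)
      \<le> 2 ^ m * (2 * pi * circle_seminorm k \<phi>)" for k
  proof -
    have "real (m choose k) \<le> 2 ^ m"
      using of_nat_mono[OF binomial_le_pow2[of m k], where 'a = real] by simp
    then have "real (m choose k) * (cmod (circle_moment (int n) \<phi>) * real n ^ k)
      \<le> 2 ^ m * (2 * pi * circle_seminorm k \<phi>)"
      by (rule mult_mono[OF _ moment]) auto
    then show ?thesis by (simp add: mult_ac)
  qed
  have "cmod (circle_moment (int n) \<phi>) * (real n + 1) ^ m =
      (\<Sum>k\<le>m. cmod (circle_moment (int n) \<phi>) * (real (m choose k) * real n ^ k))"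
    unfolding binomial_ring by (simp add: sum_distrib_left)
  also have "\<dots> \<le> (\<Sum>k\<le>m. 2 ^ m * (2 * pi * circle_seminorm k \<phi>))"
    by (intro sum_mono *)
  also have "\<dots> = 2 * pi * 2 ^ m * (\<Sum>k\<le>m. circle_seminorm k \<phi>)"
    unfolding sum_distrib_left[symmetric] by simp
  finally show ?thesis .
qed

section \<open>Absolutely convergent trigonometric series\<close>

text \<open>The frequencies are an arbitrary sequence of integers, so that the boundary values of a power
  series, the two halves of the Poisson kernel and lacunary series are all instances.\<close>
definition trig_series :: "(nat \<Rightarrow> int) \<Rightarrow> (nat \<Rightarrow> complex) \<Rightarrow> real \<Rightarrow> complex" where
  "trig_series l c t = (\<Sum>n. c n * cis (real_of_int (l n) * t))"

lemma trig_series_uniform_limit: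
  assumes "summable (\<lambda>n. cmod (c n))"
  shows "uniform_limit S (\<lambda>N t. \<Sum>n<N. c n * cis (real_of_int (l n) * t)) (trig_series l c) sequentially"
  unfolding trig_series_def
  by (rule Weierstrass_m_test[OF _ assms]) (simp add: norm_mult)

lemma trig_series_continuous_on:
  assumes "summable (\<lambda>n. cmod (c n))"
  shows "continuous_on S (trig_series l c)"
  by (rule uniform_limit_theorem[OF _ trig_series_uniform_limit[OF assms]])
     (intro eventuallyI continuous_intros, simp)

lemma norm_trig_series_le:
  assumes "summable (\<lambda>n. cmod (c n))"
  shows "cmod (trig_series l c t) \<le> (\<Sum>n. cmod (c n))"
proof -
  have "cmod (trig_series l c t) \<le> (\<Sum>n. cmod (c n * cis (real_of_int (l n) * t)))"
    unfolding trig_series_def by (rule summable_norm) (use assms in \<open>simp add: norm_mult\<close>)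
  then show ?thesis by (simp add: norm_mult)
qed

lemma trig_series_sums:
  assumes "summable (\<lambda>n. cmod (c n))"
  shows "(\<lambda>n. c n * cis (real_of_int (l n) * t)) sums trig_series l c t"
  unfolding trig_series_def
  by (intro summable_sums summable_norm_cancel[of "\<lambda>n. c n * cis (real_of_int (l n) * t)"])
     (use assms in \<open>simp add: norm_mult\<close>)

text \<open>Uniform convergence allows integrating a trigonometric series against a continuous function
  term by term. All exchanges of sum and integral below go back to this lemma.\<close>
lemma circle_moment_trig_series_pairing:
  assumes c: "summable (\<lambda>n. cmod (c n))" and g: "continuous_on {0..2*pi} g"
  shows "(\<lambda>n. c n * circle_moment (l n) g) sums integral {0..2*pi} (\<lambda>t. trig_series l c t * g t)"
proof -
  obtain B where B: "\<And>t. t \<in> {0..2*pi} \<Longrightarrow> cmod (g t) \<le> B"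
    using compact_imp_bounded[OF compact_continuous_image[OF g compact_Icc]]
    unfolding bounded_iff by blast
  have ul: "uniform_limit {0..2*pi} (\<lambda>N t. \<Sum>n<N. c n * cis (real_of_int (l n) * t) * g t)
      (\<lambda>t. \<Sum>n. c n * cis (real_of_int (l n) * t) * g t) sequentially"
    by (rule Weierstrass_m_test[of _ _ "\<lambda>n. cmod (c n) * B"])
       (auto simp: norm_mult intro!: mult_left_mono B summable_mult2 c)
  moreover have "(\<Sum>n. c n * cis (real_of_int (l n) * t) * g t) = trig_series l c t * g t" for t
    using trig_series_sums[OF c, of l t] by (metis sums_mult2 sums_unique)
  ultimately have ul: "uniform_limit {0..2*pi} (\<lambda>N t. \<Sum>n<N. c n * cis (real_of_int (l n) * t) * g t)
      (\<lambda>t. trig_series l c t * g t) sequentially"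
    by simp
  obtain I J where IJ:
    "\<And>N. ((\<lambda>t. \<Sum>n<N. c n * cis (real_of_int (l n) * t) * g t) has_integral I N) {0..2*pi}"
    "((\<lambda>t. trig_series l c t * g t) has_integral J) {0..2*pi}" "I \<longlonglongrightarrow> J"
    by (rule uniform_limit_integral[OF ul], intro continuous_intros g, simp) blast
  have "((\<lambda>t. \<Sum>n<N. c n * cis (real_of_int (l n) * t) * g t) has_integral (\<Sum>n<N. c n * circle_moment (l n) g)) {0..2*pi}" for N
    unfolding circle_moment_def mult.assoc
    by (intro has_integral_sum has_integral_mult_right integrable_integral circle_moment_integrable g) auto
  then have "I N = (\<Sum>n<N. c n * circle_moment (l n) g)" for N
    using has_integral_unique IJ(1) by blast
  then show ?thesis
    using IJ(3) unfolding sums_def integral_unique[OF IJ(2)] by presburger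
qed

lemma trig_series_has_vector_derivative:
  assumes c: "summable (\<lambda>n. cmod (c n))" and lc: "summable (\<lambda>n. \<bar>real_of_int (l n)\<bar> * cmod (c n))"
  shows "(trig_series l c has_vector_derivative trig_series l (\<lambda>n. c n * (\<i> * of_int (l n))) t) (at t)"
proof -
  let ?c' = "\<lambda>n. c n * (\<i> * of_int (l n))"
  have c': "summable (\<lambda>n. cmod (?c' n))"
    using lc by (simp add: norm_mult mult_ac)
  have "\<exists>g. \<forall>t\<in>UNIV. (\<lambda>n. c n * cis (real_of_int (l n) * t)) sums g t \<and>
      (g has_derivative (\<lambda>h. h *\<^sub>R trig_series l ?c' t)) (at t within UNIV)"
  proof (rule has_derivative_series[where f' = "\<lambda>n t h. h *\<^sub>R (?c' n * cis (real_of_int (l n) * t))" and x = 0])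
    fix n :: nat and x :: real
    have "((\<lambda>t. c n * cis (real_of_int (l n) * t)) has_vector_derivative c n * (\<i> * real_of_int (l n) * cis (real_of_int (l n) * x))) (at x)"
      by (intro has_vector_derivative_mult_right has_vector_derivative_cis_mult)
    then show "((\<lambda>t. c n * cis (real_of_int (l n) * t)) has_derivative (\<lambda>h. h *\<^sub>R (?c' n * cis (real_of_int (l n) * x)))) (at x within UNIV)"
      by (simp add: has_vector_derivative_def mult_ac)
  next
    fix e :: real assume "e > 0"
    then have "\<forall>\<^sub>F N in sequentially. \<forall>x\<in>UNIV.
        dist (\<Sum>n<N. ?c' n * cis (real_of_int (l n) * x)) (trig_series l ?c' x) < e"
      using trig_series_uniform_limit[OF c', where S = UNIV and l = l] unfolding uniform_limit_iff by blast
    then show "\<forall>\<^sub>F N in sequentially. \<forall>x\<in>UNIV. \<forall>h. norm ((\<Sum>n<N. h *\<^sub>R (?c' n * cis (real_of_int (l n) * x)))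
        - h *\<^sub>R trig_series l ?c' x) \<le> e * norm h"
    proof (rule eventually_mono, intro ballI allI)
      fix N x h assume "\<forall>x\<in>UNIV. dist (\<Sum>n<N. ?c' n * cis (real_of_int (l n) * x)) (trig_series l ?c' x) < e"
      then have "\<bar>h\<bar> * norm ((\<Sum>n<N. ?c' n * cis (real_of_int (l n) * x)) - trig_series l ?c' x) \<le> \<bar>h\<bar> * e"
        by (intro mult_left_mono) (auto simp: dist_norm less_imp_le)
      then show "norm ((\<Sum>n<N. h *\<^sub>R (?c' n * cis (real_of_int (l n) * x))) - h *\<^sub>R trig_series l ?c' x) \<le> e * norm h"
        by (simp only: scaleR_sum_right[symmetric] scaleR_diff_right[symmetric] norm_scaleR)
           (simp add: mult.commute)
    qed
  qed (use trig_series_sums[OF c, of l 0] in auto)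
  then obtain g where g: "\<And>t. (\<lambda>n. c n * cis (real_of_int (l n) * t)) sums g t"
      "\<And>t. (g has_vector_derivative trig_series l ?c' t) (at t)"
    by (auto simp: has_vector_derivative_def)
  have "g = trig_series l c"
    using g(1) trig_series_sums[OF c] sums_unique2 by blast
  with g(2) show ?thesis by simp
qed

text \<open>Coefficients that stay summable after multiplication by any power of the frequency give a
  smooth function, because the series can then be differentiated term by term arbitrarily often.\<close>
lemma
  assumes summ: "\<And>k. summable (\<lambda>n. \<bar>real_of_int (l n)\<bar> ^ k * cmod (c n))"
  shows trig_series_circle_Cinf: "trig_series l c \<in> circle_Cinf" (is ?B)
    and circle_seminorm_trig_series_le:
      "circle_seminorm k (trig_series l c) \<le> (\<Sum>n. \<bar>real_of_int (l n)\<bar> ^ k * cmod (c n))" (is ?C)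
proof -
  have norm_eq: "cmod (c n * (\<i> * of_int (l n)) ^ k) = \<bar>real_of_int (l n)\<bar> ^ k * cmod (c n)" for n k
    by (simp add: norm_mult norm_power mult.commute)
  have deriv: "(trig_series l (\<lambda>n. c n * (\<i> * of_int (l n)) ^ k) has_vector_derivative
      trig_series l (\<lambda>n. c n * (\<i> * of_int (l n)) ^ Suc k) t) (at t)" for k t
  proof -
    have "(trig_series l (\<lambda>n. c n * (\<i> * of_int (l n)) ^ k) has_vector_derivative
      trig_series l (\<lambda>n. (c n * (\<i> * of_int (l n)) ^ k) * (\<i> * of_int (l n))) t) (at t)"
      using summ[of k] summ[of "Suc k"]
      by (intro trig_series_has_vector_derivative) (simp_all add: norm_eq mult.assoc)
    then show ?thesis by (simp add: mult_ac)
  qed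
  have A: "nth_vderiv k (trig_series l c) = trig_series l (\<lambda>n. c n * (\<i> * of_int (l n)) ^ k)" for k
  proof (induction k)
    case (Suc k)
    then show ?case
      using vector_derivative_at[OF deriv[of k]] by (auto simp only: nth_vderiv_Suc)
  qed simp
  have period: "cis (real_of_int m * (t + 2 * pi)) = cis (real_of_int m * t)" for m t
    using cis_multiple_2pi[of m] by (simp add: distrib_left mult.commute flip: cis_mult)
  show ?B
    unfolding circle_Cinf_def mem_Collect_eq A
  proof (intro conjI allI)
    show "trig_series l c (t + 2 * pi) = trig_series l c t" for t
      unfolding trig_series_def period ..
  qed (rule differentiableI_vector[OF deriv])
  show ?C
    unfolding circle_seminorm_def A
  proof (rule cSUP_least)
    fix t
    have "cmod (trig_series l (\<lambda>n. c n * (\<i> * of_int (l n)) ^ k) t)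
        \<le> (\<Sum>n. cmod (c n * (\<i> * of_int (l n)) ^ k))"
      using summ[of k] by (intro norm_trig_series_le) (simp add: norm_eq)
    then show "cmod (trig_series l (\<lambda>n. c n * (\<i> * of_int (l n)) ^ k) t)
        \<le> (\<Sum>n. \<bar>real_of_int (l n)\<bar> ^ k * cmod (c n))"
      by (simp add: norm_eq)
  qed simp
qed

section \<open>Geometric series with polynomial weights\<close>

lemma power_Suc_increment_le:
  fixes x :: real
  assumes "x \<ge> 0"
  shows "(x + 1) ^ Suc k - x ^ Suc k \<le> (real k + 1) * (x + 1) ^ k"
proof (induction k)
  case (Suc k)
  have "(x + 1) ^ Suc (Suc k) - x ^ Suc (Suc k)
      = x * ((x + 1) ^ Suc k - x ^ Suc k) + (x + 1) ^ Suc k"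
    by (simp add: algebra_simps)
  also have "\<dots> \<le> x * ((real k + 1) * (x + 1) ^ k) + (x + 1) ^ Suc k"
    using Suc assms by (intro add_right_mono mult_left_mono) auto
  also have "\<dots> \<le> (x + 1) * ((real k + 1) * (x + 1) ^ k) + (x + 1) ^ Suc k"
    using assms by (intro add_right_mono mult_right_mono) auto
  also have "\<dots> = (real (Suc k) + 1) * (x + 1) ^ Suc k"
    by (simp add: algebra_simps)
  finally show ?case .
qed simp

text \<open>Each extra weight \<open>n + 1\<close> costs one factor \<open>1 / (1 - r)\<close>: multiplying the sum by \<open>1 - r\<close>
  (summation by parts) replaces the weight \<open>(n + 1) ^ Suc k\<close> by its increments, which are at most
  \<open>(k + 1) * (n + 1) ^ k\<close>. Bounding the partial sums uniformly yields convergence as well.\<close>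
lemma sum_power_mult_geometric_le:
  fixes r :: real
  assumes r: "0 \<le> r" "r < 1"
  shows "(\<Sum>n<M. (real n + 1) ^ k * r ^ n) \<le> fact k / (1 - r) ^ Suc k"
proof (induction k arbitrary: M)
  case 0
  have "(\<Sum>n<M. r ^ n) = (1 - r ^ M) / (1 - r)"
    using r by (simp add: sum_gp_strict)
  also have "\<dots> \<le> 1 / (1 - r)"
    using r by (intro divide_right_mono) auto
  finally show ?case by simp
next
  case (Suc k)
  have telescope: "(1 - r) * (\<Sum>n<M. (real n + 1) ^ Suc k * r ^ n) + real M ^ Suc k * r ^ M
      = (\<Sum>n<M. ((real n + 1) ^ Suc k - real n ^ Suc k) * r ^ n)"
  proof (induction M)
    case (Suc M)
    have "(1 - r) * (\<Sum>n<Suc M. (real n + 1) ^ Suc k * r ^ n) + real (Suc M) ^ Suc k * r ^ Suc M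
        = ((1 - r) * (\<Sum>n<M. (real n + 1) ^ Suc k * r ^ n) + real M ^ Suc k * r ^ M)
          + ((real M + 1) ^ Suc k - real M ^ Suc k) * r ^ M"
      by (simp add: algebra_simps)
    then show ?case
      unfolding Suc by simp
  qed simp
  have "(1 - r) * (\<Sum>n<M. (real n + 1) ^ Suc k * r ^ n)
      \<le> (\<Sum>n<M. ((real n + 1) ^ Suc k - real n ^ Suc k) * r ^ n)"
    using r unfolding telescope[symmetric] by simp
  also have "\<dots> \<le> (\<Sum>n<M. ((real k + 1) * (real n + 1) ^ k) * r ^ n)"
    using r by (intro sum_mono mult_right_mono power_Suc_increment_le) auto
  also have "\<dots> = (real k + 1) * (\<Sum>n<M. (real n + 1) ^ k * r ^ n)"
    by (simp add: sum_distrib_left mult.assoc)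
  also have "\<dots> \<le> (real k + 1) * (fact k / (1 - r) ^ Suc k)"
    by (intro mult_left_mono Suc) auto
  finally have "(\<Sum>n<M. (real n + 1) ^ Suc k * r ^ n)
      \<le> (real k + 1) * (fact k / (1 - r) ^ Suc k) / (1 - r)"
    using r by (intro mult_imp_le_div_pos) (simp_all only: mult.commute diff_gt_0_iff_gt)
  also have "\<dots> = fact (Suc k) / (1 - r) ^ Suc (Suc k)"
    by (simp add: add.commute mult.commute)
  finally show ?case .
qed

lemma
  fixes r :: real
  assumes r: "0 \<le> r" "r < 1"
  shows summable_power_mult_geometric: "summable (\<lambda>n. (real n + 1) ^ k * r ^ n)"
    and suminf_power_mult_geometric_le:
      "(\<Sum>n. (real n + 1) ^ k * r ^ n) \<le> fact k / (1 - r) ^ Suc k"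
proof -
  show S: "summable (\<lambda>n. (real n + 1) ^ k * r ^ n)"
    by (rule bounded_imp_summable[of _ "fact k / (1 - r) ^ Suc k"])
       (use r sum_power_mult_geometric_le[OF r, of k "Suc _"] in \<open>auto simp: lessThan_Suc_atMost\<close>)
  show "(\<Sum>n. (real n + 1) ^ k * r ^ n) \<le> fact k / (1 - r) ^ Suc k"
    by (rule suminf_le_const[OF S sum_power_mult_geometric_le[OF r]])
qed

lemma circle_seminorm_add_le:
  assumes "\<phi> \<in> circle_Cinf" "\<psi> \<in> circle_Cinf"
  shows "circle_seminorm k (\<lambda>t. \<phi> t + \<psi> t) \<le> circle_seminorm k \<phi> + circle_seminorm k \<psi>"
  unfolding circle_seminorm_def[of k "\<lambda>t. \<phi> t + \<psi> t"] nth_vderiv_add[OF assms]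
proof (rule cSUP_least)
  fix t :: real assume "t \<in> {0..2*pi}"
  then show "cmod (nth_vderiv k \<phi> t + nth_vderiv k \<psi> t) \<le> circle_seminorm k \<phi> + circle_seminorm k \<psi>"
    by (intro order_trans[OF norm_triangle_ineq] add_mono norm_nth_vderiv_le_seminorm assms)
qed simp

text \<open>By orthogonality, only the terms of frequency \<open>- n\<close> contribute to the \<open>n\<close>-th moment.\<close>
lemma circle_moment_trig_series:
  assumes "summable (\<lambda>k. cmod (c k))"
  shows "(\<lambda>k. c k * (if n + l k = 0 then 2 * pi else 0)) sums circle_moment n (trig_series l c)"
proof -
  have "(\<lambda>k. c k * circle_moment (l k) (\<lambda>t. cis (real_of_int n * t))) sums
      integral {0..2*pi} (\<lambda>t. trig_series l c t * cis (real_of_int n * t))"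
    by (intro circle_moment_trig_series_pairing assms continuous_intros)
  then show ?thesis
    by (simp only: circle_moment_cis add.commute[of n]) (simp add: circle_moment_def mult.commute)
qed

section \<open>The Poisson kernel as a test function\<close>

definition poisson_at :: "real \<Rightarrow> real \<Rightarrow> real \<Rightarrow> complex" where
  "poisson_at r \<theta> = (\<lambda>t. complex_of_real (poisson_kernel r (\<theta> - t)))"

lemma poisson_kernel_eq_geometric:
  fixes r s :: real
  assumes "0 \<le> r" "r < 1"
  defines "z \<equiv> rcis r s"
  shows "complex_of_real (poisson_kernel r s) = 1 / (1 - z) + cnj z / (1 - cnj z)"
proof -
  have "cmod z = r"
    using assms by (simp add: z_def)
  then have "z \<noteq> 1"
    using assms(2) by auto
  then have nz: "1 - z \<noteq> 0" "1 - cnj z \<noteq> 0"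
    by (auto simp: complex_cnj_cancel_iff dest: arg_cong[of _ _ cnj])
  have zz: "z * cnj z = complex_of_real (r\<^sup>2)"
    using complex_norm_square[of z] \<open>cmod z = r\<close> by simp
  have "z + cnj z = complex_of_real (2 * r * cos s)"
    by (simp add: complex_add_cnj z_def)
  then have "(1 - z) * (1 - cnj z) = complex_of_real (1 - 2 * r * cos s + r\<^sup>2)"
    using zz by (simp add: algebra_simps)
  moreover have "1 / (1 - z) + cnj z / (1 - cnj z) = (1 - z * cnj z) / ((1 - z) * (1 - cnj z))"
    using nz by (simp add: field_simps)
  ultimately show ?thesis
    by (simp add: zz poisson_kernel_def)
qed

abbreviation poisson_coeff_nonneg :: "real \<Rightarrow> real \<Rightarrow> nat \<Rightarrow> complex" where
  "poisson_coeff_nonneg r \<theta> n \<equiv> complex_of_real r ^ n * cis (real n * \<theta>)"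

abbreviation poisson_coeff_neg :: "real \<Rightarrow> real \<Rightarrow> nat \<Rightarrow> complex" where
  "poisson_coeff_neg r \<theta> n \<equiv> complex_of_real r ^ Suc n * cis (- real (Suc n) * \<theta>)"

text \<open>The expansion \<open>P\<^sub>r(s) = \<Sum>\<^sub>n r\<^bsup>\<bar>n\<bar>\<^esup> cis (n * s)\<close>, split into the terms with \<open>n \<ge> 0\<close> and those with
  \<open>n < 0\<close>. As a function of \<open>t\<close>, with \<open>s = \<theta> - t\<close>, the first part has the frequencies \<open>- n \<le> 0\<close>.\<close>
lemma poisson_at_trig_series:
  assumes "0 \<le> r" "r < 1"
  shows "poisson_at r \<theta> = (\<lambda>t. trig_series (\<lambda>n. - int n) (poisson_coeff_nonneg r \<theta>) t +
    trig_series (\<lambda>n. int (Suc n)) (poisson_coeff_neg r \<theta>) t)"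
proof
  fix t
  define z where "z = rcis r (\<theta> - t)"
  have z: "norm z < 1" "norm (cnj z) < 1"
    using assms by (simp_all add: z_def)
  have pow: "z ^ n = complex_of_real r ^ n * cis (real n * (\<theta> - t))" for n
    by (simp add: z_def DeMoivre2) (simp add: rcis_def)
  have "(\<lambda>n. z ^ n) sums (1 / (1 - z))"
    by (rule geometric_sums[OF z(1)])
  moreover have "z ^ n = poisson_coeff_nonneg r \<theta> n * cis (real_of_int (- int n) * t)" for n
    by (simp add: pow cis_mult right_diff_distrib mult.assoc)
  ultimately have 1: "trig_series (\<lambda>n. - int n) (poisson_coeff_nonneg r \<theta>) t = 1 / (1 - z)"
    unfolding trig_series_def using sums_unique by fastforce
  have "(\<lambda>n. cnj z * cnj z ^ n) sums (cnj z * (1 / (1 - cnj z)))"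
    by (intro sums_mult geometric_sums z(2))
  moreover have "cnj z * cnj z ^ n = poisson_coeff_neg r \<theta> n * cis (real_of_int (int (Suc n)) * t)" for n
  proof -
    have "cnj z * cnj z ^ n = cnj (z ^ Suc n)"
      by simp
    also have "\<dots> = complex_of_real r ^ Suc n * cis (- (real (Suc n) * (\<theta> - t)))"
      unfolding pow by (simp only: complex_cnj_mult complex_cnj_power complex_cnj_complex_of_real cis_cnj)
    also have "- (real (Suc n) * (\<theta> - t)) = - real (Suc n) * \<theta> + real_of_int (int (Suc n)) * t"
      by (simp add: algebra_simps)
    finally show ?thesis
      by (simp only: cis_mult[symmetric] mult.assoc)
  qed
  ultimately have 2: "trig_series (\<lambda>n. int (Suc n)) (poisson_coeff_neg r \<theta>) t = cnj z / (1 - cnj z)"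
    unfolding trig_series_def using sums_unique by fastforce
  show "poisson_at r \<theta> t = trig_series (\<lambda>n. - int n) (poisson_coeff_nonneg r \<theta>) t +
    trig_series (\<lambda>n. int (Suc n)) (poisson_coeff_neg r \<theta>) t"
    unfolding 1 2 poisson_at_def z_def using poisson_kernel_eq_geometric[OF assms] by simp
qed

text \<open>The seminorms of the Poisson kernel blow up only like a power of \<open>1 / (1 - r)\<close>; this is what
  turns the continuity of a distribution into a growth estimate for its Poisson integral. The moments
  at nonnegative frequencies see only one half of the expansion, and this reproduces
  \<open>z ^ n\<close> at \<open>z = rcis r \<theta>\<close>.\<close>
lemma
  assumes r: "0 \<le> r" "r < 1"
  shows poisson_at_circle_Cinf: "poisson_at r \<theta> \<in> circle_Cinf" (is ?A)
    and circle_seminorm_poisson_at_le: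
      "circle_seminorm k (poisson_at r \<theta>) \<le> 2 * fact k / (1 - r) ^ Suc k" (is ?B)
    and circle_moment_poisson_at:
      "circle_moment (int n) (poisson_at r \<theta>) = 2 * pi * (complex_of_real r ^ n * cis (real n * \<theta>))" (is ?C)
proof -
  let ?l = "\<lambda>n. - int n" and ?c = "poisson_coeff_nonneg r \<theta>"
  let ?l' = "\<lambda>n. int (Suc n)" and ?c' = "poisson_coeff_neg r \<theta>"
  have le: "\<bar>real_of_int (?l n)\<bar> ^ k * cmod (?c n) \<le> (real n + 1) ^ k * r ^ n" for n k
    using r by (auto simp: norm_mult norm_power intro!: mult_right_mono power_mono)
  have le': "\<bar>real_of_int (?l' n)\<bar> ^ k * cmod (?c' n) \<le> (real n + 1) ^ k * r ^ n" for n k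
  proof -
    have "(real n + 1) ^ k * r ^ Suc n \<le> (real n + 1) ^ k * r ^ n"
      using r by (intro mult_left_mono power_decreasing) auto
    moreover have "\<bar>real_of_int (?l' n)\<bar> ^ k * cmod (?c' n) = (real n + 1) ^ k * r ^ Suc n"
      using r unfolding norm_mult norm_power norm_cis by (simp add: add.commute)
    ultimately show ?thesis by simp
  qed
  have summ: "summable (\<lambda>n. \<bar>real_of_int (?l n)\<bar> ^ k * cmod (?c n))" for k
    by (rule summable_comparison_test'[OF summable_power_mult_geometric[OF r, of k]])
       (use le in auto)
  have summ': "summable (\<lambda>n. \<bar>real_of_int (?l' n)\<bar> ^ k * cmod (?c' n))" for k
    by (rule summable_comparison_test'[OF summable_power_mult_geometric[OF r, of k], where N = 0])
       (subst real_norm_def, subst abs_of_nonneg, simp, rule le')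
  note inC = trig_series_circle_Cinf[OF summ] trig_series_circle_Cinf[OF summ']
  show ?A
    unfolding poisson_at_trig_series[OF r] by (rule circle_Cinf_add[OF inC])
  have "circle_seminorm k (poisson_at r \<theta>)
      \<le> circle_seminorm k (trig_series ?l ?c) + circle_seminorm k (trig_series ?l' ?c')"
    unfolding poisson_at_trig_series[OF r] by (rule circle_seminorm_add_le[OF inC])
  also have "circle_seminorm k (trig_series ?l ?c) \<le> (\<Sum>n. \<bar>real_of_int (?l n)\<bar> ^ k * cmod (?c n))"
    by (rule circle_seminorm_trig_series_le[OF summ])
  also have "\<dots> \<le> (\<Sum>n. (real n + 1) ^ k * r ^ n)"
    by (intro suminf_le le summ summable_power_mult_geometric r)
  also have "\<dots> \<le> fact k / (1 - r) ^ Suc k"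
    by (rule suminf_power_mult_geometric_le[OF r])
  also have "circle_seminorm k (trig_series ?l' ?c') \<le> (\<Sum>n. \<bar>real_of_int (?l' n)\<bar> ^ k * cmod (?c' n))"
    by (rule circle_seminorm_trig_series_le[OF summ'])
  also have "\<dots> \<le> (\<Sum>n. (real n + 1) ^ k * r ^ n)"
    by (intro suminf_le le' summ' summable_power_mult_geometric r)
  also have "\<dots> \<le> fact k / (1 - r) ^ Suc k"
    by (rule suminf_power_mult_geometric_le[OF r])
  finally show ?B
    by simp
  have s: "summable (\<lambda>n. cmod (?c n))" and s': "summable (\<lambda>n. cmod (?c' n))"
    using summ[of 0] summ'[of 0] by simp_all
  have "(\<lambda>m. ?c m * (if m = n then 2 * pi else 0)) sums circle_moment (int n) (trig_series ?l ?c)"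
    using circle_moment_trig_series[OF s, of "int n" ?l] by (simp add: eq_commute[of n])
  moreover have "(\<lambda>m. ?c m * (if m = n then 2 * pi else 0)) sums (?c n * (2 * pi))"
    using sums_single[of n "\<lambda>m. ?c m * (2 * pi)"]
    by (simp add: if_distrib[of "\<lambda>x. _ * complex_of_real x"] cong: if_cong)
  ultimately have 1: "circle_moment (int n) (trig_series ?l ?c) = ?c n * (2 * pi)"
    by (rule sums_unique2)
  have "(\<lambda>m. 0) sums circle_moment (int n) (trig_series ?l' ?c')"
    using circle_moment_trig_series[OF s', of "int n" ?l'] by simp
  then have 2: "circle_moment (int n) (trig_series ?l' ?c') = 0"
    using sums_unique2 sums_zero by blast
  have "circle_moment (int n) (poisson_at r \<theta>)
      = circle_moment (int n) (trig_series ?l ?c) + circle_moment (int n) (trig_series ?l' ?c')"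
    unfolding poisson_at_trig_series[OF r]
    by (rule circle_moment_add[OF trig_series_continuous_on[OF s] trig_series_continuous_on[OF s']])
  then show ?C
    unfolding 1 2 by (simp add: mult_ac)
qed

section \<open>Coefficients of polynomial growth define distributions\<close>

definition polynomial_growth :: "(nat \<Rightarrow> complex) \<Rightarrow> bool" where
  "polynomial_growth a \<longleftrightarrow> (\<exists>C N. \<forall>n. cmod (a n) \<le> C * (real n + 1) ^ N)"

text \<open>The boundary distribution of \<open>\<Sum>n. a n * z ^ n\<close>: formally the integral against \<open>\<phi>\<close> over the unit
  circle, computed term by term.\<close>
definition boundary_functional :: "(nat \<Rightarrow> complex) \<Rightarrow> (real \<Rightarrow> complex) \<Rightarrow> complex" where
  "boundary_functional a \<phi> = (\<Sum>n. a n * circle_moment (int n) \<phi>)"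

lemma polynomial_growthE:
  assumes "polynomial_growth a"
  obtains C N where "C \<ge> 0" "\<And>n. cmod (a n) \<le> C * (real n + 1) ^ N"
proof -
  obtain C N where CN: "\<And>n. cmod (a n) \<le> C * (real n + 1) ^ N"
    using assms unfolding polynomial_growth_def by blast
  moreover have "C \<ge> 0"
    using order_trans[OF norm_ge_zero CN[of 0]] by simp
  ultimately show ?thesis using that by blast
qed

lemma summable_inverse_Suc_squared: "summable (\<lambda>n. 1 / (real n + 1) ^ 2)"
  using inverse_power_summable[of 2, where 'a = real, THEN summable_ignore_initial_segment, of 1]
  by (simp add: inverse_eq_divide add.commute)

text \<open>The decay of the moments beats the growth of the coefficients. Taking \<open>N + 2\<close> derivatives
  leaves a factor \<open>1 / (n + 1)\<^sup>2\<close>, enough for a convergent series.\<close>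
lemma coefficient_moment_bound:
  assumes C: "C \<ge> 0" "\<And>n. cmod (a n) \<le> C * (real n + 1) ^ N" and \<phi>: "\<phi> \<in> circle_Cinf"
  shows "cmod (a n * circle_moment (int n) \<phi>)
    \<le> C * (2 * pi * 2 ^ (N + 2)) * (\<Sum>k\<le>N + 2. circle_seminorm k \<phi>) * (1 / (real n + 1) ^ 2)"
proof -
  let ?x = "real n + 1" and ?m = "cmod (circle_moment (int n) \<phi>)"
  have "cmod (a n * circle_moment (int n) \<phi>) \<le> C * ?x ^ N * ?m"
    unfolding norm_mult by (intro mult_right_mono C) auto
  also have "?x ^ N = ?x ^ (N + 2) * (1 / ?x ^ 2)"
    unfolding power_add by simp
  also have "C * (?x ^ (N + 2) * (1 / ?x ^ 2)) * ?m = C * (?m * ?x ^ (N + 2)) * (1 / ?x ^ 2)"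
    by (simp only: mult_ac)
  also have "\<dots> \<le> C * (2 * pi * 2 ^ (N + 2) * (\<Sum>k\<le>N + 2. circle_seminorm k \<phi>)) * (1 / ?x ^ 2)"
    by (intro mult_right_mono mult_left_mono circle_moment_decay \<phi> C) auto
  finally show ?thesis
    by (simp add: mult.assoc)
qed

lemma summable_coefficient_moment:
  assumes "polynomial_growth a" "\<phi> \<in> circle_Cinf"
  shows "summable (\<lambda>n. cmod (a n * circle_moment (int n) \<phi>))"
proof -
  obtain C N where C: "C \<ge> 0" "\<And>n. cmod (a n) \<le> C * (real n + 1) ^ N"
    using polynomial_growthE[OF assms(1)] by blast
  show ?thesis
    by (rule summable_comparison_test'[OF summable_mult[OF summable_inverse_Suc_squared], where N = 0])
       (use coefficient_moment_bound[OF C assms(2)] in simp)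
qed

lemma boundary_functional_distribution:
  assumes "polynomial_growth a"
  shows "boundary_functional a \<in> circle_distributions"
  unfolding circle_distributions_iff
proof (intro conjI ballI allI)
  fix \<phi> \<psi> assume "\<phi> \<in> circle_Cinf" "\<psi> \<in> circle_Cinf"
  then show "boundary_functional a (\<lambda>t. \<phi> t + \<psi> t)
      = boundary_functional a \<phi> + boundary_functional a \<psi>"
    using circle_Cinf_continuous_on[of \<phi> "{0..2*pi}" 0] circle_Cinf_continuous_on[of \<psi> "{0..2*pi}" 0]
      summable_norm_cancel[OF summable_coefficient_moment[OF assms]]
    by (simp add: boundary_functional_def circle_moment_add distrib_left suminf_add)
next
  fix c \<phi> assume "\<phi> \<in> circle_Cinf"
  then show "boundary_functional a (\<lambda>t. c * \<phi> t) = c * boundary_functional a \<phi>"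
    using summable_norm_cancel[OF summable_coefficient_moment[OF assms]]
    by (simp add: boundary_functional_def circle_moment_cmult mult.left_commute[of _ c] suminf_mult)
next
  obtain C N where C: "C \<ge> 0" "\<And>n. cmod (a n) \<le> C * (real n + 1) ^ N"
    using polynomial_growthE[OF assms(1)] by blast
  define S where "S = (\<Sum>n. 1 / (real n + 1) ^ 2)"
  have "cmod (boundary_functional a \<phi>)
      \<le> (C * (2 * pi * 2 ^ (N + 2)) * S) * (\<Sum>k\<le>N + 2. circle_seminorm k \<phi>)"
    if \<phi>: "\<phi> \<in> circle_Cinf" for \<phi>
  proof -
    let ?K = "C * (2 * pi * 2 ^ (N + 2)) * (\<Sum>k\<le>N + 2. circle_seminorm k \<phi>)"
    have "cmod (boundary_functional a \<phi>) \<le> (\<Sum>n. cmod (a n * circle_moment (int n) \<phi>))"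
      unfolding boundary_functional_def
      by (rule summable_norm[OF summable_coefficient_moment[OF assms \<phi>]])
    also have "\<dots> \<le> (\<Sum>n. ?K * (1 / (real n + 1) ^ 2))"
      by (intro suminf_le coefficient_moment_bound[OF C \<phi>] summable_mult
          summable_inverse_Suc_squared summable_coefficient_moment[OF assms \<phi>])
    also have "\<dots> = ?K * S"
      unfolding S_def by (rule suminf_mult[OF summable_inverse_Suc_squared])
    finally show ?thesis
      by (simp only: mult_ac)
  qed
  moreover have "S \<ge> 0"
    unfolding S_def by (intro suminf_nonneg summable_inverse_Suc_squared) auto
  ultimately show "\<exists>C\<ge>0. \<exists>N. \<forall>\<phi>\<in>circle_Cinf.
      cmod (boundary_functional a \<phi>) \<le> C * (\<Sum>k\<le>N. circle_seminorm k \<phi>)"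
    using C(1) by (intro exI[of _ "C * (2 * pi * 2 ^ (N + 2)) * S"] conjI exI[of _ "N + 2"] ballI) auto
qed

section \<open>Boundary behaviour of a power series in the disk\<close>

locale disk_power_series =
  fixes a :: "nat \<Rightarrow> complex" and h :: "complex \<Rightarrow> complex"
  assumes sums: "cmod z < 1 \<Longrightarrow> (\<lambda>n. a n * z ^ n) sums h z"
begin

lemma summable_norm_coeff:
  assumes r: "0 \<le> r" "r < 1"
  shows "summable (\<lambda>n. cmod (a n * complex_of_real r ^ n))"
proof (rule powser_insidea)
  show "summable (\<lambda>n. a n * complex_of_real ((1 + r) / 2) ^ n)"
    using r by (intro sums_summable[OF sums]) (simp del: of_real_divide of_real_add)
  show "cmod (complex_of_real r) < cmod (complex_of_real ((1 + r) / 2))"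
    using r by (simp del: of_real_divide of_real_add)
qed

lemma on_circle:
  assumes "0 \<le> r" "r < 1"
  shows "h (rcis r t) = trig_series int (\<lambda>n. a n * complex_of_real r ^ n) t"
proof -
  have "(\<lambda>n. a n * rcis r t ^ n) sums h (rcis r t)"
    using assms by (intro sums) simp
  moreover have "rcis r t ^ n = complex_of_real r ^ n * cis (real n * t)" for n
    by (simp add: DeMoivre2) (simp add: rcis_def)
  ultimately show ?thesis
    unfolding trig_series_def by (simp add: mult.assoc sums_iff)
qed

lemma continuous_on_circle:
  assumes "0 \<le> r" "r < 1"
  shows "continuous_on S (\<lambda>t. h (rcis r t))"
  unfolding on_circle[OF assms] by (rule trig_series_continuous_on[OF summable_norm_coeff[OF assms]])

lemma integral_circle_sums:
  assumes "0 \<le> r" "r < 1" "continuous_on {0..2*pi} g"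
  shows "(\<lambda>n. a n * complex_of_real r ^ n * circle_moment (int n) g) sums
    integral {0..2*pi} (\<lambda>t. h (rcis r t) * g t)"
  unfolding on_circle[OF assms(1,2)]
  by (rule circle_moment_trig_series_pairing[OF summable_norm_coeff[OF assms(1,2)] assms(3)])

text \<open>The integral formula for the Taylor coefficients.\<close>
lemma circle_moment_on_circle:
  assumes r: "0 \<le> r" "r < 1"
  shows "circle_moment (- int n) (\<lambda>t. h (rcis r t)) = 2 * pi * (a n * complex_of_real r ^ n)"
proof -
  have "(\<lambda>k. a k * complex_of_real r ^ k * (if k = n then 2 * pi else 0)) sums
      circle_moment (- int n) (\<lambda>t. h (rcis r t))"
    using circle_moment_trig_series[OF summable_norm_coeff[OF r], of "- int n" int]
    by (simp add: on_circle[OF r])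
  moreover have "(\<lambda>k. a k * complex_of_real r ^ k * (if k = n then 2 * pi else 0)) sums
      (a n * complex_of_real r ^ n * (2 * pi))"
    using sums_single[of n "\<lambda>k. a k * complex_of_real r ^ k * (2 * pi)"]
    by (simp add: if_distrib[of "\<lambda>x. _ * complex_of_real x"] cong: if_cong)
  ultimately show ?thesis
    using sums_unique2 by (simp add: mult.commute)
qed

lemma norm_le_if_polynomial_growth:
  assumes "polynomial_growth a"
  obtains C N where "\<And>r t. 0 \<le> r \<Longrightarrow> r < 1 \<Longrightarrow> cmod (h (rcis r t)) \<le> C / (1 - r) ^ N"
proof -
  obtain C N where C: "C \<ge> 0" "\<And>n. cmod (a n) \<le> C * (real n + 1) ^ N"
    using polynomial_growthE[OF assms(1)] by blast
  have "cmod (h (rcis r t)) \<le> (C * fact N) / (1 - r) ^ Suc N" if r: "0 \<le> r" "r < 1" for r t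
  proof -
    have "cmod (h (rcis r t)) \<le> (\<Sum>n. cmod (a n * complex_of_real r ^ n))"
      unfolding on_circle[OF r] by (rule norm_trig_series_le[OF summable_norm_coeff[OF r]])
    also have "\<dots> \<le> (\<Sum>n. C * ((real n + 1) ^ N * r ^ n))"
    proof (rule suminf_le[OF _ summable_norm_coeff[OF r] summable_mult[OF summable_power_mult_geometric[OF r]]])
      fix n
      have "cmod (a n) * r ^ n \<le> C * (real n + 1) ^ N * r ^ n"
        using r by (intro mult_right_mono C) auto
      then show "cmod (a n * complex_of_real r ^ n) \<le> C * ((real n + 1) ^ N * r ^ n)"
        using r by (simp add: norm_mult norm_power mult.assoc)
    qed
    also have "\<dots> = C * (\<Sum>n. (real n + 1) ^ N * r ^ n)"
      by (rule suminf_mult[OF summable_power_mult_geometric[OF r]])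
    also have "\<dots> \<le> C * (fact N / (1 - r) ^ Suc N)"
      by (intro mult_left_mono suminf_power_mult_geometric_le r C)
    finally show ?thesis by simp
  qed
  then show ?thesis using that by blast
qed

text \<open>The integral formula for \<open>a n\<close> is applied on the circle of radius \<open>1 - 1 / (2 * (n + 1))\<close>. There
  \<open>r ^ n\<close> stays above \<open>1 / 2\<close> by Bernoulli's inequality, while \<open>1 / (1 - r)\<close> is of the order of \<open>n\<close>.\<close>
lemma polynomial_growth_if_norm_le:
  assumes bound: "\<And>r t. 0 \<le> r \<Longrightarrow> r < 1 \<Longrightarrow> cmod (h (rcis r t)) \<le> C / (1 - r) ^ N"
  shows "polynomial_growth a"
  unfolding polynomial_growth_def
proof (intro exI allI)
  fix n
  define \<delta> where "\<delta> = 1 / (2 * (real n + 1))"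
  define r where "r = 1 - \<delta>"
  have \<delta>: "0 < \<delta>" "\<delta> \<le> 1 / 2"
    by (simp_all add: \<delta>_def field_simps)
  then have r: "0 \<le> r" "r < 1"
    by (simp_all add: r_def)
  have "1 / 2 \<le> 1 - real n * \<delta>"
    by (simp add: \<delta>_def field_simps)
  also have "\<dots> \<le> r ^ n"
    using Bernoulli_inequality[of "- \<delta>" n] \<delta> by (simp add: r_def)
  finally have rn: "1 / 2 \<le> r ^ n" .
  have "2 * pi * (cmod (a n) * r ^ n) = cmod (circle_moment (- int n) (\<lambda>t. h (rcis r t)))"
    unfolding circle_moment_on_circle[OF r] using r by (simp add: norm_mult norm_power)
  also have "\<dots> \<le> 2 * pi * (C / (1 - r) ^ N)"
    by (intro norm_circle_moment_le continuous_on_circle bound r)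
  finally have "cmod (a n) * r ^ n \<le> C / (1 - r) ^ N"
    by (rule mult_left_le_imp_le) simp
  moreover have "cmod (a n) * (1 / 2) \<le> cmod (a n) * r ^ n"
    by (intro mult_left_mono rn) auto
  moreover have "C / (1 - r) ^ N = C * 2 ^ N * (real n + 1) ^ N"
  proof -
    have "1 - r = 1 / (2 * (real n + 1))"
      by (simp add: r_def \<delta>_def)
    then show ?thesis
      by (simp only: power_one_over divide_divide_eq_right div_by_1 power_mult_distrib mult.assoc)
  qed
  ultimately show "cmod (a n) \<le> (2 * C * 2 ^ N) * (real n + 1) ^ N"
    by simp
qed

text \<open>A power series with coefficients of polynomial growth is the Poisson integral of its boundary
  distribution, since the moments of the Poisson kernel are \<open>2 * pi * z ^ n\<close>.\<close>
lemma boundary_functional_poisson_at: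
  assumes r: "0 \<le> r" "r < 1"
  shows "boundary_functional a (poisson_at r \<theta>) = 2 * pi * h (rcis r \<theta>)"
proof -
  have "(\<lambda>n. 2 * pi * (a n * complex_of_real r ^ n * cis (real_of_int (int n) * \<theta>))) sums
      (2 * pi * h (rcis r \<theta>))"
    unfolding on_circle[OF r] by (intro sums_mult trig_series_sums summable_norm_coeff r)
  then show ?thesis
    by (simp add: boundary_functional_def circle_moment_poisson_at[OF r] sums_iff mult_ac)
qed

text \<open>Tannery's theorem applies because the series for \<open>r = 1\<close> converges absolutely and dominates
  those for \<open>r < 1\<close>.\<close>
lemma tendsto_boundary_functional:
  assumes growth: "polynomial_growth a" and \<phi>: "\<phi> \<in> circle_Cinf"
  shows "((\<lambda>r. integral {0..2*pi} (\<lambda>t. h (rcis r t) * \<phi> t)) \<longlongrightarrow> boundary_functional a \<phi>) (at_left 1)"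
proof -
  let ?b = "\<lambda>n r. a n * complex_of_real r ^ n * circle_moment (int n) \<phi>"
  have in01: "\<forall>\<^sub>F r in at_left (1::real). 0 \<le> r \<and> r < 1"
    using eventually_at_left_real[OF zero_less_one] by (rule eventually_mono) auto
  have "((\<lambda>r. \<Sum>n. ?b n r) \<longlongrightarrow> (\<Sum>n. ?b n 1)) (at_left 1)"
  proof (rule tannerys_theorem[THEN conjunct2, THEN conjunct2])
    show "((\<lambda>r. ?b n r) \<longlongrightarrow> ?b n 1) (at_left 1)" for n
      by (intro tendsto_intros)
    show "summable (\<lambda>n. cmod (a n * circle_moment (int n) \<phi>))"
      by (rule summable_coefficient_moment[OF growth \<phi>])
    have bound: "cmod (?b n r) \<le> cmod (a n * circle_moment (int n) \<phi>)" if r: "0 \<le> r \<and> r < 1" for n r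
    proof -
      have "(cmod (a n) * cmod (circle_moment (int n) \<phi>)) * r ^ n
          \<le> (cmod (a n) * cmod (circle_moment (int n) \<phi>)) * 1"
        using r by (intro mult_left_mono power_le_one) auto
      then show ?thesis
        using r by (simp add: norm_mult norm_power mult_ac)
    qed
    show "\<forall>\<^sub>F (n, r) in at_top \<times>\<^sub>F at_left 1. cmod (?b n r) \<le> cmod (a n * circle_moment (int n) \<phi>)"
      by (rule eventually_mono[OF eventually_prodI[OF eventually_True in01]]) (use bound in auto)
  qed simp
  moreover have "\<forall>\<^sub>F r in at_left 1. (\<Sum>n. ?b n r) = integral {0..2*pi} (\<lambda>t. h (rcis r t) * \<phi> t)"
    using in01
    by (rule eventually_mono)
       (use circle_Cinf_continuous_on[OF \<phi>, of _ 0] in \<open>auto intro!: sums_unique[symmetric] integral_circle_sums\<close>)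
  ultimately show ?thesis
    by (simp add: boundary_functional_def tendsto_cong)
qed

text \<open>A gliding hump. If the coefficients outgrow every polynomial, there are indices \<open>s k\<close> with
  \<open>cmod (a (s k)) > (s k + 1) ^ k\<close>, and then \<open>\<Sum>k. cis (- s k * t) / a (s k)\<close> is a test function. Its
  pairing with the power series on the circle of radius \<open>r\<close> is \<open>\<Sum>k. 2 * pi * r ^ s k\<close>. All terms
  are positive, and each tends to \<open>2 * pi\<close>, so the pairing has no limit as \<open>r\<close> tends to \<open>1\<close>. The
  explicit choice of coefficients takes the place of the uniform boundedness principle in the
  Frechet space of test functions.\<close>
lemma polynomial_growth_if_limits:
  assumes lim: "\<And>\<phi>. \<phi> \<in> circle_Cinf \<Longrightarrow>
    \<exists>L. ((\<lambda>r. integral {0..2*pi} (\<lambda>t. h (rcis r t) * \<phi> t)) \<longlongrightarrow> L) (at_left 1)"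
  shows "polynomial_growth a"
proof (rule ccontr)
  assume no_growth: "\<not> polynomial_growth a"
  have large: "\<exists>n\<ge>m. (real n + 1) ^ k < cmod (a n)" for m k
  proof (rule ccontr)
    assume "\<not> ?thesis"
    then have le: "cmod (a n) \<le> (real n + 1) ^ k" if "n \<ge> m" for n
      using that by (meson not_less)
    (* The finitely many indices below m are absorbed by the constant. *)
    define C where "C = 1 + (\<Sum>i<m. cmod (a i))"
    have C: "C \<ge> 1"
      by (simp add: C_def sum_nonneg)
    have "cmod (a n) \<le> C * (real n + 1) ^ k" for n
    proof (cases "n < m")
      case True
      then have "cmod (a n) \<le> C"
        unfolding C_def by (intro add_increasing member_le_sum) auto
      also have "\<dots> \<le> C * (real n + 1) ^ k"
        using C mult_left_mono[OF one_le_power[of "real n + 1" k], of C] by simp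
      finally show ?thesis .
    next
      case False
      then have "cmod (a n) \<le> 1 * (real n + 1) ^ k"
        using le[of n] by simp
      also have "\<dots> \<le> C * (real n + 1) ^ k"
        using C by (intro mult_right_mono) auto
      finally show ?thesis .
    qed
    then show False
      using no_growth unfolding polynomial_growth_def by blast
  qed
  obtain s where s: "\<And>k. (real (s k) + 1) ^ k < cmod (a (s k))" and mono: "\<And>k. s k < s (Suc k)"
    using dependent_nat_choice[of "\<lambda>k n. (real n + 1) ^ k < cmod (a n)" "\<lambda>k n n'. n < n'"]
      large by (meson Suc_le_eq)
  have s_ge: "k \<le> s k" for k
    using mono by (intro seq_suble) (simp add: strict_mono_Suc_iff)
  have a_nz: "a (s k) \<noteq> 0" for k
    using s[of k] order_le_less_trans[OF zero_le_power[of "real (s k) + 1" k] s[of k]] by auto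
  (* The coefficients cancel those of the power series, so that every hump contributes the same
     amount to the pairing. *)
  define l where "l k = - int (s k)" for k
  define c where "c k = 1 / a (s k)" for k
  have summ: "summable (\<lambda>k. \<bar>real_of_int (l k)\<bar> ^ j * cmod (c k))" for j
  proof (rule summable_comparison_test'[OF summable_inverse_Suc_squared, where N = "j + 2"])
    fix k assume k: "k \<ge> j + 2"
    let ?x = "real (s k) + 1"
    have "real (s k) ^ j / cmod (a (s k)) \<le> ?x ^ j / ?x ^ k"
      using s[of k] by (intro frac_le power_mono) auto
    also have "\<dots> \<le> ?x ^ j / ?x ^ (j + 2)"
      using k by (intro divide_left_mono power_increasing) auto
    also have "\<dots> = 1 / ?x ^ 2"
      unfolding power_add by simp
    also have "\<dots> \<le> 1 / (real k + 1) ^ 2"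
      using s_ge[of k] by (intro divide_left_mono power_mono) auto
    finally show "norm (\<bar>real_of_int (l k)\<bar> ^ j * cmod (c k)) \<le> 1 / (real k + 1) ^ 2"
      by (simp add: l_def c_def norm_divide)
  qed
  let ?I = "\<lambda>r. integral {0..2*pi} (\<lambda>t. h (rcis r t) * trig_series l c t)"
  have I: "(\<lambda>k. 2 * pi * r ^ s k) sums Re (?I r)" if r: "0 \<le> r" "r < 1" for r
  proof -
    have "(\<lambda>k. c k * circle_moment (l k) (\<lambda>t. h (rcis r t))) sums ?I r"
      using circle_moment_trig_series_pairing[OF _ continuous_on_circle[OF r], of c l] summ[of 0]
      by (simp add: mult.commute)
    moreover have "c k * circle_moment (l k) (\<lambda>t. h (rcis r t)) = complex_of_real (2 * pi * r ^ s k)" for k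
      using a_nz[of k] unfolding l_def c_def circle_moment_on_circle[OF r] by simp
    ultimately have "(\<lambda>k. complex_of_real (2 * pi * r ^ s k)) sums ?I r"
      by simp
    from sums_Re[OF this] show ?thesis by (simp only: Re_complex_of_real)
  qed
  obtain L where L: "(?I \<longlongrightarrow> L) (at_left 1)"
    using lim[OF trig_series_circle_Cinf[OF summ]] by blast
  have "2 * pi * real K \<le> Re L" for K
  proof (rule tendsto_le)
    show "((\<lambda>r. Re (?I r)) \<longlongrightarrow> Re L) (at_left 1)"
      by (intro tendsto_intros L)
    have "((\<lambda>r. \<Sum>k<K. 2 * pi * r ^ s k) \<longlongrightarrow> (\<Sum>k<K. 2 * pi * 1 ^ s k)) (at_left 1)"
      by (intro tendsto_intros)
    then show "((\<lambda>r. \<Sum>k<K. 2 * pi * r ^ s k) \<longlongrightarrow> 2 * pi * real K) (at_left 1)"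
      by (simp add: mult_ac)
    have "(\<Sum>k<K. 2 * pi * r ^ s k) \<le> Re (?I r)" if r: "r \<in> {0<..<1}" for r
      using I[of r] r sum_le_suminf[of "\<lambda>k. 2 * pi * r ^ s k" "{..<K}"] by (simp add: sums_iff)
    then show "\<forall>\<^sub>F r in at_left 1. (\<Sum>k<K. 2 * pi * r ^ s k) \<le> Re (?I r)"
      by (rule eventually_mono[OF eventually_at_left_real[OF zero_less_one], rotated]) simp
  qed simp
  moreover obtain K where "Re L < real K"
    using reals_Archimedean2 by blast
  moreover have "real K \<le> 2 * pi * real K"
    using mult_right_mono[of 1 "2 * pi" "real K"] pi_ge_two by simp
  ultimately show False
    by (meson not_less order_trans)
qed

text \<open>A distribution is bounded by finitely many seminorms, say those of order at most \<open>N\<close>, and on the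
  Poisson kernel these are at most a multiple of \<open>1 / (1 - r) ^ (N + 1)\<close>.\<close>
lemma norm_le_if_poisson_integral:
  fixes u :: "(real \<Rightarrow> complex) \<Rightarrow> complex"
  assumes u: "u \<in> circle_distributions"
    and poisson: "\<And>r \<theta>. 0 \<le> r \<Longrightarrow> r < 1 \<Longrightarrow> h (rcis r \<theta>) = 1 / (2 * complex_of_real pi) * u (poisson_at r \<theta>)"
  obtains C N where "\<And>r t. 0 \<le> r \<Longrightarrow> r < 1 \<Longrightarrow> cmod (h (rcis r t)) \<le> C / (1 - r) ^ N"
proof -
  obtain C N where C: "C \<ge> 0"
    "\<And>\<phi>. \<phi> \<in> circle_Cinf \<Longrightarrow> cmod (u \<phi>) \<le> C * (\<Sum>k\<le>N. circle_seminorm k \<phi>)"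
    using u unfolding circle_distributions_iff by blast
  have "cmod (h (rcis r t)) \<le> (1 / (2 * pi) * (C * (real (Suc N) * (2 * fact N)))) / (1 - r) ^ Suc N"
    if r: "0 \<le> r" "r < 1" for r t
  proof -
    have "circle_seminorm k (poisson_at r t) \<le> 2 * fact N / (1 - r) ^ Suc N" if "k \<le> N" for k
    proof -
      have "circle_seminorm k (poisson_at r t) \<le> 2 * fact k / (1 - r) ^ Suc k"
        by (rule circle_seminorm_poisson_at_le[OF r])
      also have "\<dots> \<le> 2 * fact N / (1 - r) ^ Suc N"
        using r that by (intro frac_le mult_left_mono fact_mono power_decreasing) auto
      finally show ?thesis .
    qed
    then have "(\<Sum>k\<le>N. circle_seminorm k (poisson_at r t)) \<le> (\<Sum>k\<le>N. 2 * fact N / (1 - r) ^ Suc N)"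
      by (intro sum_mono) auto
    also have "\<dots> = real (Suc N) * (2 * fact N) / (1 - r) ^ Suc N"
      by (simp only: sum_constant card_atMost) simp
    finally have "cmod (u (poisson_at r t)) \<le> C * (real (Suc N) * (2 * fact N) / (1 - r) ^ Suc N)"
      using C(2)[OF poisson_at_circle_Cinf[OF r]] C(1) by (meson mult_left_mono order_trans)
    then have "1 / (2 * pi) * cmod (u (poisson_at r t))
        \<le> 1 / (2 * pi) * (C * (real (Suc N) * (2 * fact N) / (1 - r) ^ Suc N))"
      by (intro mult_left_mono) auto
    moreover have "cmod (h (rcis r t)) = 1 / (2 * pi) * cmod (u (poisson_at r t))"
      by (simp add: poisson[OF r] norm_mult norm_divide)
    ultimately show ?thesis
      by simp
  qed
  then show ?thesis using that by blast
qed

lemma limits_iff_polynomial_growth: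
  "(\<forall>\<phi>\<in>circle_Cinf. \<exists>L.
      ((\<lambda>r. integral {0..2*pi} (\<lambda>t. h (rcis r t) * \<phi> t)) \<longlongrightarrow> L) (at_left 1)) \<longleftrightarrow>
    polynomial_growth a"
  by (intro iffI ballI polynomial_growth_if_limits)
     (auto intro: tendsto_boundary_functional)

lemma norm_le_iff_polynomial_growth:
  "(\<exists>C N. \<forall>r \<theta>. 0 \<le> r \<and> r < 1 \<longrightarrow> cmod (h (rcis r \<theta>)) \<le> C / (1 - r) ^ N) \<longleftrightarrow>
    polynomial_growth a" (is "?L \<longleftrightarrow> _")
proof
  assume ?L
  then obtain C N where "\<And>r \<theta>. 0 \<le> r \<and> r < 1 \<Longrightarrow> cmod (h (rcis r \<theta>)) \<le> C / (1 - r) ^ N"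
    by blast
  then show "polynomial_growth a"
    by (intro polynomial_growth_if_norm_le[of C N]) simp
next
  assume growth: "polynomial_growth a"
  obtain C N where "\<And>r t. 0 \<le> r \<Longrightarrow> r < 1 \<Longrightarrow> cmod (h (rcis r t)) \<le> C / (1 - r) ^ N"
    by (rule norm_le_if_polynomial_growth[OF growth]) blast
  then show ?L
    by (intro exI[of _ C] exI[of _ N]) simp
qed

lemma poisson_integral_iff_polynomial_growth:
  "(\<exists>u\<in>circle_distributions. \<forall>r \<theta>. 0 \<le> r \<and> r < 1 \<longrightarrow>
      h (rcis r \<theta>) = 1 / (2 * complex_of_real pi) * u (poisson_at r \<theta>)) \<longleftrightarrow>
    polynomial_growth a" (is "?L \<longleftrightarrow> _")
proof
  assume ?L
  then obtain u :: "(real \<Rightarrow> complex) \<Rightarrow> complex" where u: "u \<in> circle_distributions"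
    "\<And>r \<theta>. 0 \<le> r \<Longrightarrow> r < 1 \<Longrightarrow> h (rcis r \<theta>) = 1 / (2 * complex_of_real pi) * u (poisson_at r \<theta>)"
    by auto
  obtain C N where "\<And>r t. 0 \<le> r \<Longrightarrow> r < 1 \<Longrightarrow> cmod (h (rcis r t)) \<le> C / (1 - r) ^ N"
    by (rule norm_le_if_poisson_integral[OF u]) blast+
  then show "polynomial_growth a"
    by (rule polynomial_growth_if_norm_le)
next
  assume growth: "polynomial_growth a"
  show ?L
    by (rule bexI[OF _ boundary_functional_distribution[OF growth]])
       (simp add: boundary_functional_poisson_at)
qed

end

section \<open>Reduction of bicomplex functions to their components\<close>

lemma disk_power_series_holomorphic:
  assumes "g holomorphic_on ball 0 1"
  shows "disk_power_series (\<lambda>n. (deriv ^^ n) g 0 / fact n) g"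
proof
  fix z :: complex assume "cmod z < 1"
  then show "(\<lambda>n. (deriv ^^ n) g 0 / fact n * z ^ n) sums g z"
    using holomorphic_power_series[OF assms, of z] by simp
qed

lemma bounded_linear_bc_pplus: "bounded_linear (\<lambda>x. bc_pplus * bc_of_complex x)"
  by (intro linear_conv_bounded_linear[THEN iffD1] linearI) (simp_all add: bc_components_eq_iff)

lemma bounded_linear_bc_pminus: "bounded_linear (\<lambda>x. bc_pminus * bc_of_complex x)"
  by (intro linear_conv_bounded_linear[THEN iffD1] linearI) (simp_all add: bc_components_eq_iff)

lemma has_integral_bicomplex:
  assumes "((\<lambda>t. bc_plus (g t)) has_integral I) S" "((\<lambda>t. bc_minus (g t)) has_integral J) S"
  shows "(g has_integral (bc_pplus * bc_of_complex I + bc_pminus * bc_of_complex J)) S"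
proof -
  have "((\<lambda>t. bc_pplus * bc_of_complex (bc_plus (g t)) + bc_pminus * bc_of_complex (bc_minus (g t)))
      has_integral (bc_pplus * bc_of_complex I + bc_pminus * bc_of_complex J)) S"
    using has_integral_linear[OF assms(1) bounded_linear_bc_pplus]
      has_integral_linear[OF assms(2) bounded_linear_bc_pminus]
    by (intro has_integral_add) (simp_all add: o_def)
  then show ?thesis
    by (simp flip: bc_decomposition)
qed

lemma norm_bicomplex_le: "norm w \<le> cmod (bc_plus w) + cmod (bc_minus w)"
proof -
  have "norm w \<le> sqrt ((cmod (bc_plus w) + cmod (bc_minus w))\<^sup>2)"
    unfolding norm_bicomplex_def by (intro real_sqrt_le_mono) (simp add: power2_sum)
  then show ?thesis by simp
qed

lemma conj_distribution_conj_distribution [simp]: "conj_distribution (conj_distribution u) = u"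
  by (simp add: conj_distribution_def fun_eq_iff)

text \<open>The conjugation in the plus component is moved to the test function: the integral of
  \<open>bc_plus f * \<phi>\<close> is the conjugate of the integral of \<open>cnj (bc_plus f) * cnj \<phi>\<close>, and \<open>cnj \<phi>\<close> runs
  through all test functions as \<open>\<phi>\<close> does.\<close>
lemma bicomplex_limits_iff:
  assumes f: "f \<in> bc_Hol"
  shows "(\<forall>\<phi>\<in>circle_Cinf. \<exists>L.
      ((\<lambda>r. integral {0..2*pi} (\<lambda>\<theta>. f (rcis r \<theta>) * bc_of_complex (\<phi> \<theta>))) \<longlongrightarrow> L) (at_left 1)) \<longleftrightarrow>
    (\<forall>\<phi>\<in>circle_Cinf. \<exists>L.
      ((\<lambda>r. integral {0..2*pi} (\<lambda>\<theta>. cnj (bc_plus (f (rcis r \<theta>))) * \<phi> \<theta>)) \<longlongrightarrow> L) (at_left 1)) \<and>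
    (\<forall>\<phi>\<in>circle_Cinf. \<exists>L.
      ((\<lambda>r. integral {0..2*pi} (\<lambda>\<theta>. bc_minus (f (rcis r \<theta>)) * \<phi> \<theta>)) \<longlongrightarrow> L) (at_left 1))"
    (is "?B \<longleftrightarrow> ?P \<and> ?M")
proof -
  define I where "I \<phi> r = integral {0..2*pi} (\<lambda>\<theta>. f (rcis r \<theta>) * bc_of_complex (\<phi> \<theta>))" for \<phi> r
  define P where "P \<phi> r = integral {0..2*pi} (\<lambda>\<theta>. cnj (bc_plus (f (rcis r \<theta>))) * \<phi> \<theta>)" for \<phi> r
  define M where "M \<phi> r = integral {0..2*pi} (\<lambda>\<theta>. bc_minus (f (rcis r \<theta>)) * \<phi> \<theta>)" for \<phi> r
  let ?cj = "\<lambda>\<phi> t. cnj (\<phi> t)"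
  from f have "(\<lambda>z. cnj (bc_plus (f z))) holomorphic_on ball 0 1"
    and "(\<lambda>z. bc_minus (f z)) holomorphic_on ball 0 1"
    by (simp_all add: bc_Hol_iff)
  note cont = this[THEN disk_power_series_holomorphic, THEN disk_power_series.continuous_on_circle]
  have I: "I \<phi> r = bc_pplus * bc_of_complex (cnj (P (?cj \<phi>) r)) + bc_pminus * bc_of_complex (M \<phi> r)"
    if \<phi>: "\<phi> \<in> circle_Cinf" and r: "0 \<le> r" "r < 1" for \<phi> r
    unfolding I_def
  proof (intro integral_unique has_integral_bicomplex)
    have c\<phi>: "continuous_on {0..2*pi} \<phi>"
      using circle_Cinf_continuous_on[OF \<phi>, of _ 0] by simp
    have "((\<lambda>t. cnj (bc_plus (f (rcis r t))) * cnj (\<phi> t)) has_integral P (?cj \<phi>) r) {0..2*pi}"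
      unfolding P_def
      by (intro integrable_integral integrable_continuous_real continuous_intros c\<phi> cont r)
    from has_integral_linear[OF this bounded_linear_cnj]
    show "((\<lambda>t. bc_plus (f (rcis r t) * bc_of_complex (\<phi> t))) has_integral cnj (P (?cj \<phi>) r)) {0..2*pi}"
      by (simp add: o_def)
    have "((\<lambda>t. bc_minus (f (rcis r t)) * \<phi> t) has_integral M \<phi> r) {0..2*pi}"
      unfolding M_def
      by (intro integrable_integral integrable_continuous_real continuous_intros c\<phi> cont r)
    then show "((\<lambda>t. bc_minus (f (rcis r t) * bc_of_complex (\<phi> t))) has_integral M \<phi> r) {0..2*pi}"
      by simp
  qed
  have in01: "\<forall>\<^sub>F r in at_left (1::real). 0 \<le> r \<and> r < 1"
    using eventually_at_left_real[OF zero_less_one] by (rule eventually_mono) auto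
  have lim_plus: "((\<lambda>r. P (?cj \<phi>) r) \<longlongrightarrow> cnj (bc_plus L)) (at_left 1)"
    and lim_minus: "((\<lambda>r. M \<phi> r) \<longlongrightarrow> bc_minus L) (at_left 1)"
    if \<phi>: "\<phi> \<in> circle_Cinf" and L: "(I \<phi> \<longlongrightarrow> L) (at_left 1)" for \<phi> L
  proof -
    have "((\<lambda>r. cnj (bc_plus (I \<phi> r))) \<longlongrightarrow> cnj (bc_plus L)) (at_left 1)"
      by (intro tendsto_cnj bounded_linear.tendsto[OF bounded_linear_bc_plus] L)
    then show "((\<lambda>r. P (?cj \<phi>) r) \<longlongrightarrow> cnj (bc_plus L)) (at_left 1)"
      by (rule Lim_transform_eventually) (use in01 in eventually_elim, simp add: I[OF \<phi>])
    have "((\<lambda>r. bc_minus (I \<phi> r)) \<longlongrightarrow> bc_minus L) (at_left 1)"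
      by (intro bounded_linear.tendsto[OF bounded_linear_bc_minus] L)
    then show "((\<lambda>r. M \<phi> r) \<longlongrightarrow> bc_minus L) (at_left 1)"
      by (rule Lim_transform_eventually) (use in01 in eventually_elim, simp add: I[OF \<phi>])
  qed
  have lim_both: "(I \<phi> \<longlongrightarrow> bc_pplus * bc_of_complex (cnj K) + bc_pminus * bc_of_complex L) (at_left 1)"
    if \<phi>: "\<phi> \<in> circle_Cinf" and K: "(P (?cj \<phi>) \<longlongrightarrow> K) (at_left 1)" and L: "(M \<phi> \<longlongrightarrow> L) (at_left 1)"
    for \<phi> K L
  proof -
    have "((\<lambda>r. bc_pplus * bc_of_complex (cnj (P (?cj \<phi>) r)) + bc_pminus * bc_of_complex (M \<phi> r))
        \<longlongrightarrow> bc_pplus * bc_of_complex (cnj K) + bc_pminus * bc_of_complex L) (at_left 1)"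
      by (intro tendsto_add bounded_linear.tendsto[OF bounded_linear_bc_pplus]
          bounded_linear.tendsto[OF bounded_linear_bc_pminus] tendsto_cnj K L)
    then show ?thesis
      by (rule Lim_transform_eventually) (use in01 in eventually_elim, simp add: I[OF \<phi>])
  qed
  have "(\<forall>\<phi>\<in>circle_Cinf. \<exists>L. (I \<phi> \<longlongrightarrow> L) (at_left 1)) \<longleftrightarrow>
    (\<forall>\<phi>\<in>circle_Cinf. \<exists>L. (P \<phi> \<longlongrightarrow> L) (at_left 1)) \<and> (\<forall>\<phi>\<in>circle_Cinf. \<exists>L. (M \<phi> \<longlongrightarrow> L) (at_left 1))"
  proof (intro iffI conjI ballI)
    fix \<phi> assume "\<forall>\<phi>\<in>circle_Cinf. \<exists>L. (I \<phi> \<longlongrightarrow> L) (at_left 1)" and \<phi>: "\<phi> \<in> circle_Cinf"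
    then obtain K L where "(I \<phi> \<longlongrightarrow> L) (at_left 1)" "(I (?cj \<phi>) \<longlongrightarrow> K) (at_left 1)"
      using circle_Cinf_cnj by blast
    then show "\<exists>L. (P \<phi> \<longlongrightarrow> L) (at_left 1)" "\<exists>L. (M \<phi> \<longlongrightarrow> L) (at_left 1)"
      using lim_plus[OF circle_Cinf_cnj[OF \<phi>]] lim_minus[OF \<phi>] by auto
  next
    fix \<phi> assume "(\<forall>\<phi>\<in>circle_Cinf. \<exists>L. (P \<phi> \<longlongrightarrow> L) (at_left 1)) \<and>
        (\<forall>\<phi>\<in>circle_Cinf. \<exists>L. (M \<phi> \<longlongrightarrow> L) (at_left 1))" and "\<phi> \<in> circle_Cinf"
    then show "\<exists>L. (I \<phi> \<longlongrightarrow> L) (at_left 1)"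
      using lim_both circle_Cinf_cnj by metis
  qed
  then show ?thesis
    by (simp only: I_def[abs_def] P_def[abs_def] M_def[abs_def])
qed

text \<open>Conjugation is an involution on distributions, so the plus component of \<open>f\<^sub>b\<close> and the distribution
  representing \<open>cnj (bc_plus f)\<close> determine each other.\<close>
lemma bicomplex_poisson_iff:
  "(\<exists>f\<^sub>b\<in>bc_circle_distributions. \<forall>r \<theta>. 0 \<le> r \<and> r < 1 \<longrightarrow>
      f (rcis r \<theta>) =
        bc_pplus * bc_of_complex (cnj (1 / (2 * complex_of_real pi) *
          conj_distribution (bc_plus \<circ> f\<^sub>b) (poisson_at r \<theta>))) +
        bc_pminus * bc_of_complex (1 / (2 * complex_of_real pi) *
          (bc_minus \<circ> f\<^sub>b) (poisson_at r \<theta>))) \<longleftrightarrow>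
    (\<exists>u\<in>circle_distributions. \<forall>r \<theta>. 0 \<le> r \<and> r < 1 \<longrightarrow>
      cnj (bc_plus (f (rcis r \<theta>))) = 1 / (2 * complex_of_real pi) * u (poisson_at r \<theta>)) \<and>
    (\<exists>u\<in>circle_distributions. \<forall>r \<theta>. 0 \<le> r \<and> r < 1 \<longrightarrow>
      bc_minus (f (rcis r \<theta>)) = 1 / (2 * complex_of_real pi) * u (poisson_at r \<theta>))"
    (is "?B \<longleftrightarrow> ?P \<and> ?M")
proof
  assume ?B
  then obtain f\<^sub>b where fb: "f\<^sub>b \<in> bc_circle_distributions"
    and eq: "\<And>r \<theta>. 0 \<le> r \<Longrightarrow> r < 1 \<Longrightarrow> f (rcis r \<theta>) =
        bc_pplus * bc_of_complex (cnj (1 / (2 * complex_of_real pi) *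
          conj_distribution (bc_plus \<circ> f\<^sub>b) (poisson_at r \<theta>))) +
        bc_pminus * bc_of_complex (1 / (2 * complex_of_real pi) *
          (bc_minus \<circ> f\<^sub>b) (poisson_at r \<theta>))"
    by blast
  have "conj_distribution (bc_plus \<circ> f\<^sub>b) \<in> circle_distributions" "bc_minus \<circ> f\<^sub>b \<in> circle_distributions"
    using fb by (simp_all add: bc_circle_distributions_def circle_distributions_conj)
  then show "?P \<and> ?M"
    by (intro conjI; elim bexI[rotated]) (simp_all add: eq)
next
  assume "?P \<and> ?M"
  then obtain u v where uv: "u \<in> circle_distributions" "v \<in> circle_distributions"
    and u: "\<And>r \<theta>. 0 \<le> r \<Longrightarrow> r < 1 \<Longrightarrow>
      cnj (bc_plus (f (rcis r \<theta>))) = 1 / (2 * complex_of_real pi) * u (poisson_at r \<theta>)"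
    and v: "\<And>r \<theta>. 0 \<le> r \<Longrightarrow> r < 1 \<Longrightarrow>
      bc_minus (f (rcis r \<theta>)) = 1 / (2 * complex_of_real pi) * v (poisson_at r \<theta>)"
    by blast
  define f\<^sub>b where "f\<^sub>b \<phi> = bc_pplus * bc_of_complex (conj_distribution u \<phi>) + bc_pminus * bc_of_complex (v \<phi>)" for \<phi>
  have comp: "bc_plus \<circ> f\<^sub>b = conj_distribution u" "bc_minus \<circ> f\<^sub>b = v"
    by (simp_all add: f\<^sub>b_def fun_eq_iff)
  show ?B
  proof (intro bexI[of _ f\<^sub>b] allI impI)
    show "f\<^sub>b \<in> bc_circle_distributions"
      using uv by (simp add: bc_circle_distributions_def comp circle_distributions_conj)
    fix r \<theta> :: real assume "0 \<le> r \<and> r < 1"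
    then show "f (rcis r \<theta>) = bc_pplus * bc_of_complex (cnj (1 / (2 * complex_of_real pi) *
          conj_distribution (bc_plus \<circ> f\<^sub>b) (poisson_at r \<theta>))) +
        bc_pminus * bc_of_complex (1 / (2 * complex_of_real pi) *
          (bc_minus \<circ> f\<^sub>b) (poisson_at r \<theta>))"
      unfolding comp conj_distribution_conj_distribution
      by (simp only: u[symmetric] v[symmetric] complex_cnj_cnj bc_decomposition[symmetric])
  qed
qed

lemma divide_power_mono_exponent:
  fixes d :: real
  assumes "0 < d" "d \<le> 1" "C \<le> C'" "0 \<le> C'" "N \<le> N'"
  shows "C / d ^ N \<le> C' / d ^ N'"
  using assms by (intro frac_le power_decreasing) auto

text \<open>The norm is equivalent to the larger of the two component norms. Enlarging the exponent only
  weakens the bound because \<open>1 - r \<le> 1\<close>; this makes real and natural exponents interchangeable and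
  gives both components a common one.\<close>
lemma bicomplex_norm_le_iff:
  "(\<exists>C>0. \<exists>\<alpha>\<ge>0. \<forall>r \<theta>. 0 \<le> r \<and> r < 1 \<longrightarrow> norm (f (rcis r \<theta>)) \<le> C / (1 - r) powr \<alpha>) \<longleftrightarrow>
    (\<exists>C N. \<forall>r \<theta>. 0 \<le> r \<and> r < 1 \<longrightarrow> cmod (cnj (bc_plus (f (rcis r \<theta>)))) \<le> C / (1 - r) ^ N) \<and>
    (\<exists>C N. \<forall>r \<theta>. 0 \<le> r \<and> r < 1 \<longrightarrow> cmod (bc_minus (f (rcis r \<theta>))) \<le> C / (1 - r) ^ N)"
    (is "?B \<longleftrightarrow> ?P \<and> ?M")
proof
  assume ?B
  then obtain C \<alpha> where C: "C > 0" "\<alpha> \<ge> 0"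
    and bound: "\<And>r \<theta>. 0 \<le> r \<Longrightarrow> r < 1 \<Longrightarrow> norm (f (rcis r \<theta>)) \<le> C / (1 - r) powr \<alpha>"
    by blast
  define N where "N = nat \<lceil>\<alpha>\<rceil>"
  have N: "\<alpha> \<le> real N"
    unfolding N_def by (rule real_nat_ceiling_ge)
  have *: "norm (f (rcis r \<theta>)) * sqrt 2 \<le> (C * sqrt 2) / (1 - r) ^ N" if r: "0 \<le> r" "r < 1" for r \<theta>
  proof -
    have "(1 - r) ^ N = (1 - r) powr real N"
      using r by (simp add: powr_realpow)
    also have "\<dots> \<le> (1 - r) powr \<alpha>"
      using r N by (intro powr_mono') auto
    finally have "C / (1 - r) powr \<alpha> \<le> C / (1 - r) ^ N"
      using C r by (intro divide_left_mono) auto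
    then have "norm (f (rcis r \<theta>)) \<le> C / (1 - r) ^ N"
      using bound[OF r] by (rule order_trans[rotated])
    then show ?thesis
      using mult_right_mono[of _ _ "sqrt 2"] by fastforce
  qed
  have "cmod (cnj (bc_plus (f (rcis r \<theta>)))) \<le> (C * sqrt 2) / (1 - r) ^ N"
    "cmod (bc_minus (f (rcis r \<theta>))) \<le> (C * sqrt 2) / (1 - r) ^ N" if "0 \<le> r \<and> r < 1" for r \<theta>
    using order_trans[OF norm_bc_plus_le *[of r \<theta>]] order_trans[OF norm_bc_minus_le *[of r \<theta>]] that by simp_all
  then show "?P \<and> ?M"
    by blast
next
  assume "?P \<and> ?M"
  then obtain C N C' N' where
    p: "\<And>r \<theta>. 0 \<le> r \<Longrightarrow> r < 1 \<Longrightarrow> cmod (cnj (bc_plus (f (rcis r \<theta>)))) \<le> C / (1 - r) ^ N" and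
    m: "\<And>r \<theta>. 0 \<le> r \<Longrightarrow> r < 1 \<Longrightarrow> cmod (bc_minus (f (rcis r \<theta>))) \<le> C' / (1 - r) ^ N'"
    by blast
  define K where "K = max N N'"
  have "norm (f (rcis r \<theta>)) \<le> (\<bar>C\<bar> + \<bar>C'\<bar> + 1) / (1 - r) powr real K" if r: "0 \<le> r" "r < 1" for r \<theta>
  proof -
    have "norm (f (rcis r \<theta>)) \<le> C / (1 - r) ^ N + C' / (1 - r) ^ N'"
      using norm_bicomplex_le[of "f (rcis r \<theta>)"] p[OF r, of \<theta>] m[OF r, of \<theta>] by simp
    also have "\<dots> \<le> \<bar>C\<bar> / (1 - r) ^ K + (\<bar>C'\<bar> + 1) / (1 - r) ^ K"
      using r by (intro add_mono divide_power_mono_exponent) (auto simp: K_def)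
    also have "\<dots> = (\<bar>C\<bar> + \<bar>C'\<bar> + 1) / (1 - r) powr real K"
      using r by (simp add: powr_realpow add_divide_distrib)
    finally show ?thesis .
  qed
  then show ?B
    by (intro exI[of _ "\<bar>C\<bar> + \<bar>C'\<bar> + 1"] conjI exI[of _ "real K"]) auto
qed

theorem theorem3p10:
  fixes f :: "complex \<Rightarrow> bicomplex"
  assumes "f \<in> bc_Hol"
  shows
    "let
       cond1 =
         (\<forall>\<phi>\<in>circle_Cinf. \<exists>L.
            ((\<lambda>r. integral {0..2*pi} (\<lambda>\<theta>. f (rcis r \<theta>) * bc_of_complex (\<phi> \<theta>))) \<longlongrightarrow> L)
              (at_left 1));
       cond2 =
         (\<exists>f\<^sub>b\<in>bc_circle_distributions. \<forall>r \<theta>. 0 \<le> r \<and> r < 1 \<longrightarrow>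
            f (rcis r \<theta>) =
              bc_pplus * bc_of_complex (cnj (1 / (2 * complex_of_real pi) *
                conj_distribution (bc_plus \<circ> f\<^sub>b)
                  (\<lambda>t. complex_of_real (poisson_kernel r (\<theta> - t))))) +
              bc_pminus * bc_of_complex (1 / (2 * complex_of_real pi) *
                (bc_minus \<circ> f\<^sub>b) (\<lambda>t. complex_of_real (poisson_kernel r (\<theta> - t)))));
       cond3 =
         (\<exists>C>0. \<exists>\<alpha>\<ge>0. \<forall>r \<theta>. 0 \<le> r \<and> r < 1 \<longrightarrow>
            norm (f (rcis r \<theta>)) \<le> C / (1 - r) powr \<alpha>)
     in (cond1 \<longleftrightarrow> cond2) \<and> (cond2 \<longleftrightarrow> cond3)"
proof -
  let ?a = "\<lambda>n. (deriv ^^ n) (\<lambda>z. cnj (bc_plus (f z))) 0 / fact n"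
  let ?b = "\<lambda>n. (deriv ^^ n) (\<lambda>z. bc_minus (f z)) 0 / fact n"
  interpret plus: disk_power_series ?a "\<lambda>z. cnj (bc_plus (f z))"
    using assms by (intro disk_power_series_holomorphic) (simp add: bc_Hol_iff)
  interpret minus: disk_power_series ?b "\<lambda>z. bc_minus (f z)"
    using assms by (intro disk_power_series_holomorphic) (simp add: bc_Hol_iff)
  let ?growth = "polynomial_growth ?a \<and> polynomial_growth ?b"
  note cond1 = bicomplex_limits_iff[OF assms, unfolded
      plus.limits_iff_polynomial_growth minus.limits_iff_polynomial_growth]
  note cond2 = bicomplex_poisson_iff[of f, unfolded
      plus.poisson_integral_iff_polynomial_growth minus.poisson_integral_iff_polynomial_growth,
      unfolded poisson_at_def]
  note cond3 = bicomplex_norm_le_iff[of f, unfolded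
      plus.norm_le_iff_polynomial_growth minus.norm_le_iff_polynomial_growth]
  show ?thesis
    unfolding Let_def cond1 cond2 cond3 by simp
qed

end
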